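(* Let $(H,\rho)$ be a complete CAT(0) space with the geodesic extension property, and let $A : H \rightrightarrows TH$ be a monotone vector field satisfying the surjectivity condition, with $A^{-1}(\mathbf{0})\neq\emptyset$. Let $\{S(t)\}_{t\ge0}$ be the semigroup on $\overline{\operatorname{dom}A}$ generated by $A$, i.e. $S(t)x:=\lim_{k\to\infty}J_{t/k}^{k}x$ for $x\in\overline{\operatorname{dom}A}$ and $t\ge0$ (this limit exists). Let $x\in\overline{\operatorname{dom}A}$. Then $(S(t)x)_{t\ge0}$ is bounded. Moreover, if all $\Delta$-accumulation points of $(S(t)x)_{t\ge0}$ (as $t\to\infty$) are contained in $A^{-1}(\mathbf{0})$, then $(S(t)x)_{t\ge0}$ is $\Delta$-convergent, as $t\to\infty$, to a stationary point, i.e. to an element of $A^{-1}(\mathbf{0})$.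
   Context: Geodesics. In a complete CAT(0) space $(H,\rho)$, $\gamma_{x,y}:[0,1]\to H$ denotes the unique geodesic from $x$ to $y$ parametrized with constant speed $\rho(x,y)$; it is called a zero geodesic if $x=y$. For a normalized geodesic $\gamma$ (i.e. parametrized on $[0,1]$ with constant speed), $\zeta(\gamma)=0$ if $\gamma$ is a zero geodesic and $\zeta(\gamma)=1$ otherwise. $H$ has the geodesic extension property if for all $p,q\in H$ there is $\eta:\mathbb{R}\to H$ with $\eta(0)=p$, $\eta(1)=q$ and $\rho(\eta(s),\eta(t))=\rho(p,q)|s-t|$ for all $s,t\in\mathbb{R}$. Tangent spaces. For $q,r\ne p$, the comparison angle $\overline\angle_p(q,r)$ is the angle at $\bar p$ in a Euclidean triangle $\bar p\bar q\bar r$ with the same side lengths as $p,q,r$; set $\overline\angle_p(p,p)=0$ and $\overline\angle_p(p,r)=\overline\angle_p(r,p)=\pi/2$ for $r\neq p$. The Alexandrov angle of geodesics $\gamma_1,\gamma_2$ issuing from $p$ is $\alpha_p(\gamma_1,\gamma_2)=\lim_{s,t\to0^+}\overline\angle_p(\gamma_1(s),\gamma_2(t))$. $S_p$ is the set of normalized geodesics issuing from $p$, modulo the relation $\alpha_p=0$, with induced metric $\angle_p$. $T_pH=([0,\infty)\times S_p)/\!\sim$, where $(t_1,\gamma_1)\sim(t_2,\gamma_2)$ iff either $t_1\zeta(\gamma_1)=t_2\zeta(\gamma_2)=0$, or $t_1\zeta(\gamma_1)=t_2\zeta(\gamma_2)>0$ and $\gamma_1=\gamma_2$ in $S_p$.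 The class of $(t,\gamma)$ is written $t\gamma$, and $\gamma$ stands for $1\gamma$. Put $0_p=0\gamma$ (also equal to $t\gamma_{p,p}$) and $g_p(t_1\gamma_1,t_2\gamma_2)=t_1t_2\zeta(\gamma_1)\zeta(\gamma_2)\cos\angle_p(\gamma_1,\gamma_2)$. $TH=\bigcup_{p\in H}T_pH$. Vector fields. A vector field is a set-valued map $A:H\rightrightarrows TH$ with $Ap\subset T_pH$ for all $p$ (possibly empty); $\operatorname{dom}A=\{p: Ap\neq\emptyset\}$; $A^{-1}(\mathbf 0)=\{p\in H: 0_p\in Ap\}$ is the set of stationary points. $A$ is monotone if $g_p(\eta,\gamma_{p,q})\le -g_q(\nu,\gamma_{q,p})$ whenever $\eta\in Ap$, $\nu\in Aq$. $A$ satisfies the surjectivity condition if for all $t>0$ and $x\in H$ there is $p\in H$ with $t\rho(p,x)\gamma_{p,x}\in Ap$. For $\lambda>0$, the resolvent is $J_\lambda x=\{z\in H:\lambda^{-1}\rho(z,x)\gamma_{z,x}\in Az\}$, which is a singleton for every $x\in H$ when $A$ is monotone with the surjectivity condition, and is then regarded as a map $J_\lambda:H\to H$; $J_0$ is the identity map. $J_\lambda^k$ denotes the $k$-fold composition. $\Delta$-convergence. The asymptotic center of a bounded sequence $(x^k)$ in $H$ is the unique minimizer over $H$ of $y\mapsto\limsup_k\rho(y,x^k)$. A bounded sequence is $\Delta$-convergent to $z$ if $z$ is the asymptotic center of each of its subsequences. For a bounded family $(x_t)_{t\ge0}$: a $\Delta$-accumulation point (as $t\to\infty$) is a point that is the $\Delta$-limit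 of $(x_{t_k})$ for some sequence $t_k\to\infty$; $(x_t)$ is $\Delta$-convergent to $z$ as $t\to\infty$ if $(x_{t_k})$ is $\Delta$-convergent to $z$ for every sequence $t_k\to\infty$. *)

theory Defs
  imports "HOL-Analysis.Analysis"
begin

section \<open>CAT(0) spaces\<close>

text \<open>
  Geodesics live on the unit interval. They are represented by functions that are
  \<^const>\<open>undefined\<close> outside of it, so that equality of geodesics is equality of functions.
\<close>

definition geodesics :: "(real \<Rightarrow> 'a::metric_space) set" where
  "geodesics = {\<gamma> \<in> extensional {0..1}.
     \<forall>s\<in>{0..1}. \<forall>t\<in>{0..1}. dist (\<gamma> s) (\<gamma> t) = dist (\<gamma> 0) (\<gamma> 1) * \<bar>s - t\<bar>}"

text \<open>The complex numbers serve as the Euclidean plane.\<close>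

definition comparison_triangle ::
  "'a::metric_space \<Rightarrow> 'a \<Rightarrow> 'a \<Rightarrow> complex \<Rightarrow> complex \<Rightarrow> complex \<Rightarrow> bool" where
  "comparison_triangle p q r p' q' r' \<longleftrightarrow>
     dist p' q' = dist p q \<and> dist p' r' = dist p r \<and> dist q' r' = dist q r"

text \<open>
  In the comparison axiom the two sides issue from a common vertex. This is no restriction:
  two points on different sides of a triangle lie on two sides that share a vertex (and
  geodesics may be reversed), and for two points on the same side there is nothing to compare.
\<close>

class cat0_space = metric_space +
  assumes geodesic_exists: "\<exists>\<gamma>\<in>geodesics. \<gamma> 0 = p \<and> \<gamma> 1 = q"
    and cat0_comparison:
      "\<lbrakk>\<gamma> \<in> geodesics; \<delta> \<in> geodesics; \<gamma> 0 = p; \<gamma> 1 = q; \<delta> 0 = p; \<delta> 1 = r;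
        comparison_triangle p q r p' q' r'; s \<in> {0..1}; t \<in> {0..1}\<rbrakk> \<Longrightarrow>
       dist (\<gamma> s) (\<delta> t) \<le> dist (p' + s *\<^sub>R (q' - p')) (p' + t *\<^sub>R (r' - p'))"

definition geodesic :: "'a::metric_space \<Rightarrow> 'a \<Rightarrow> real \<Rightarrow> 'a" where
  "geodesic x y = (THE \<gamma>. \<gamma> \<in> geodesics \<and> \<gamma> 0 = x \<and> \<gamma> 1 = y)"

definition geodesic_extension_property :: "'a::metric_space itself \<Rightarrow> bool" where
  "geodesic_extension_property _ \<longleftrightarrow>
     (\<forall>p q::'a. \<exists>\<eta>::real \<Rightarrow> 'a. \<eta> 0 = p \<and> \<eta> 1 = q \<and>
        (\<forall>s t. dist (\<eta> s) (\<eta> t) = dist p q * \<bar>s - t\<bar>))"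


section \<open>Tangent spaces\<close>

definition euclidean_angle :: "complex \<Rightarrow> complex \<Rightarrow> complex \<Rightarrow> real" where
  "euclidean_angle p q r = arccos (((q - p) \<bullet> (r - p)) / (norm (q - p) * norm (r - p)))"

definition comparison_angle :: "'a::metric_space \<Rightarrow> 'a \<Rightarrow> 'a \<Rightarrow> real" where
  "comparison_angle p q r =
     (if q = p \<and> r = p then 0
      else if q = p \<or> r = p then pi / 2
      else (THE \<theta>. \<exists>p' q' r'. comparison_triangle p q r p' q' r' \<and> \<theta> = euclidean_angle p' q' r'))"

definition alexandrov_angle ::
  "'a::metric_space \<Rightarrow> (real \<Rightarrow> 'a) \<Rightarrow> (real \<Rightarrow> 'a) \<Rightarrow> real" where
  "alexandrov_angle p \<gamma>\<^sub>1 \<gamma>\<^sub>2 =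
     Lim (at_right 0 \<times>\<^sub>F at_right 0) (\<lambda>(s, t). comparison_angle p (\<gamma>\<^sub>1 s) (\<gamma>\<^sub>2 t))"

definition geodesics_from :: "'a::metric_space \<Rightarrow> (real \<Rightarrow> 'a) set" where
  "geodesics_from p = {\<gamma> \<in> geodesics. \<gamma> 0 = p}"

definition direction_rel :: "'a::metric_space \<Rightarrow> ((real \<Rightarrow> 'a) \<times> (real \<Rightarrow> 'a)) set" where
  "direction_rel p = {(\<gamma>\<^sub>1, \<gamma>\<^sub>2). \<gamma>\<^sub>1 \<in> geodesics_from p \<and> \<gamma>\<^sub>2 \<in> geodesics_from p \<and>
     alexandrov_angle p \<gamma>\<^sub>1 \<gamma>\<^sub>2 = 0}"

type_synonym 'a direction = "(real \<Rightarrow> 'a) set"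

definition directions :: "'a::metric_space \<Rightarrow> 'a direction set" where
  "directions p = geodesics_from p // direction_rel p"

text \<open>
  The angle between directions and the function \<open>\<zeta>\<close> are given by their common value on all
  representatives. By the conventions in \<^const>\<open>comparison_angle\<close>, the zero geodesic
  forms a class of its own.
\<close>

definition direction_angle :: "'a::metric_space \<Rightarrow> 'a direction \<Rightarrow> 'a direction \<Rightarrow> real" where
  "direction_angle p c\<^sub>1 c\<^sub>2 = (THE a. \<exists>\<gamma>\<^sub>1\<in>c\<^sub>1. \<exists>\<gamma>\<^sub>2\<in>c\<^sub>2. a = alexandrov_angle p \<gamma>\<^sub>1 \<gamma>\<^sub>2)"

definition zeta :: "(real \<Rightarrow> 'a) \<Rightarrow> real" where
  "zeta \<gamma> = (if \<gamma> 0 = \<gamma> 1 then 0 else 1)"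

definition direction_zeta :: "'a direction \<Rightarrow> real" where
  "direction_zeta c = (THE z. \<exists>\<gamma>\<in>c. z = zeta \<gamma>)"

type_synonym 'a tangent = "(real \<times> 'a direction) set"

definition tangent_rel ::
  "'a::metric_space \<Rightarrow> ((real \<times> 'a direction) \<times> (real \<times> 'a direction)) set" where
  "tangent_rel p = {((t\<^sub>1, c\<^sub>1), (t\<^sub>2, c\<^sub>2)).
     t\<^sub>1 \<ge> 0 \<and> t\<^sub>2 \<ge> 0 \<and> c\<^sub>1 \<in> directions p \<and> c\<^sub>2 \<in> directions p \<and>
     (t\<^sub>1 * direction_zeta c\<^sub>1 = 0 \<and> t\<^sub>2 * direction_zeta c\<^sub>2 = 0 \<or>
      t\<^sub>1 * direction_zeta c\<^sub>1 = t\<^sub>2 * direction_zeta c\<^sub>2 \<and> t\<^sub>1 * direction_zeta c\<^sub>1 > 0 \<and> c\<^sub>1 = c\<^sub>2)}"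

definition tangent_space :: "'a::metric_space \<Rightarrow> 'a tangent set" where
  "tangent_space p = ({0..} \<times> directions p) // tangent_rel p"

text \<open>The tangent vector \<open>t\<gamma>\<close> at \<open>p\<close>, for \<open>\<gamma>\<close> issuing from \<open>p\<close>.\<close>

definition tangent_vector :: "'a::metric_space \<Rightarrow> real \<Rightarrow> (real \<Rightarrow> 'a) \<Rightarrow> 'a tangent" where
  "tangent_vector p t \<gamma> = tangent_rel p `` {(t, direction_rel p `` {\<gamma>})}"

definition zero_vector :: "'a::metric_space \<Rightarrow> 'a tangent" where
  "zero_vector p = tangent_vector p 0 (geodesic p p)"

definition tangent_inner :: "'a::metric_space \<Rightarrow> 'a tangent \<Rightarrow> 'a tangent \<Rightarrow> real" where
  "tangent_inner p v w = (THE a. \<exists>(t\<^sub>1, c\<^sub>1)\<in>v. \<exists>(t\<^sub>2, c\<^sub>2)\<in>w.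
     a = t\<^sub>1 * t\<^sub>2 * direction_zeta c\<^sub>1 * direction_zeta c\<^sub>2 * cos (direction_angle p c\<^sub>1 c\<^sub>2))"


section \<open>Vector fields\<close>

definition vector_field :: "('a::metric_space \<Rightarrow> 'a tangent set) \<Rightarrow> bool" where
  "vector_field A \<longleftrightarrow> (\<forall>p. A p \<subseteq> tangent_space p)"

definition vf_dom :: "('a \<Rightarrow> 'a tangent set) \<Rightarrow> 'a set" where
  "vf_dom A = {p. A p \<noteq> {}}"

definition stationary_points :: "('a::metric_space \<Rightarrow> 'a tangent set) \<Rightarrow> 'a set" where
  "stationary_points A = {p. zero_vector p \<in> A p}"

definition monotone_vf :: "('a::metric_space \<Rightarrow> 'a tangent set) \<Rightarrow> bool" where
  "monotone_vf A \<longleftrightarrow> (\<forall>p q. \<forall>\<eta>\<in>A p. \<forall>\<nu>\<in>A q.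
     tangent_inner p \<eta> (tangent_vector p 1 (geodesic p q))
       \<le> - tangent_inner q \<nu> (tangent_vector q 1 (geodesic q p)))"

definition surjectivity_condition :: "('a::metric_space \<Rightarrow> 'a tangent set) \<Rightarrow> bool" where
  "surjectivity_condition A \<longleftrightarrow>
     (\<forall>t>0. \<forall>x. \<exists>p. tangent_vector p (t * dist p x) (geodesic p x) \<in> A p)"

definition resolvent_set :: "('a::metric_space \<Rightarrow> 'a tangent set) \<Rightarrow> real \<Rightarrow> 'a \<Rightarrow> 'a set" where
  "resolvent_set A \<mu> x = {z. tangent_vector z (inverse \<mu> * dist z x) (geodesic z x) \<in> A z}"

definition resolvent :: "('a::metric_space \<Rightarrow> 'a tangent set) \<Rightarrow> real \<Rightarrow> 'a \<Rightarrow> 'a" where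
  "resolvent A \<mu> x = (if \<mu> = 0 then x else the_elem (resolvent_set A \<mu> x))"

definition semigroup_approx ::
  "('a::metric_space \<Rightarrow> 'a tangent set) \<Rightarrow> real \<Rightarrow> 'a \<Rightarrow> nat \<Rightarrow> 'a" where
  "semigroup_approx A t x k = (resolvent A (t / real k) ^^ k) x"

definition generated_semigroup :: "('a::metric_space \<Rightarrow> 'a tangent set) \<Rightarrow> real \<Rightarrow> 'a \<Rightarrow> 'a" where
  "generated_semigroup A t x = lim (semigroup_approx A t x)"


section \<open>Delta-convergence\<close>

definition asymptotic_radius_at :: "(nat \<Rightarrow> 'a::metric_space) \<Rightarrow> 'a \<Rightarrow> ereal" where
  "asymptotic_radius_at X y = limsup (\<lambda>k. ereal (dist y (X k)))"

definition is_asymptotic_center :: "(nat \<Rightarrow> 'a::metric_space) \<Rightarrow> 'a \<Rightarrow> bool" where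
  "is_asymptotic_center X z \<longleftrightarrow>
     is_arg_min (asymptotic_radius_at X) (\<lambda>_. True) z \<and>
     (\<forall>y. is_arg_min (asymptotic_radius_at X) (\<lambda>_. True) y \<longrightarrow> y = z)"

definition delta_lim :: "(nat \<Rightarrow> 'a::metric_space) \<Rightarrow> 'a \<Rightarrow> bool" where
  "delta_lim X z \<longleftrightarrow>
     bounded (range X) \<and> (\<forall>r::nat \<Rightarrow> nat. strict_mono r \<longrightarrow> is_asymptotic_center (X \<circ> r) z)"

text \<open>Families indexed by \<open>[0,\<infinity>)\<close>: only their values at nonnegative arguments matter.\<close>

definition delta_accumulation_point :: "(real \<Rightarrow> 'a::metric_space) \<Rightarrow> 'a \<Rightarrow> bool" where
  "delta_accumulation_point f z \<longleftrightarrow>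
     (\<exists>\<tau>::nat \<Rightarrow> real. (\<forall>k. \<tau> k \<ge> 0) \<and> filterlim \<tau> at_top sequentially \<and> delta_lim (\<lambda>k. f (\<tau> k)) z)"

definition delta_lim_at_top :: "(real \<Rightarrow> 'a::metric_space) \<Rightarrow> 'a \<Rightarrow> bool" where
  "delta_lim_at_top f z \<longleftrightarrow>
     (\<forall>\<tau>::nat \<Rightarrow> real. (\<forall>k. \<tau> k \<ge> 0) \<longrightarrow> filterlim \<tau> at_top sequentially \<longrightarrow>
        delta_lim (\<lambda>k. f (\<tau> k)) z)"

end

theory Submission
  imports Defs "HOL-Library.Diagonal_Subsequence"
begin

text \<open>
  Alexandrov angles are bounded by comparison angles, so monotonicity yields, for
  \<open>z = J\<^sub>\<nu> x\<close> and \<open>w = J\<^sub>\<mu> y\<close>, the purely metric inequality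
  \<open>(\<nu> + \<mu>) \<rho>(z,w)\<^sup>2 + \<mu> \<rho>(z,x)\<^sup>2 + \<nu> \<rho>(w,y)\<^sup>2 \<le> \<mu> \<rho>(x,w)\<^sup>2 + \<nu> \<rho>(y,z)\<^sup>2\<close>.
  Combined with the quadrilateral inequality of CAT(0) spaces it makes resolvents nonexpansive;
  read as a recursion for squared distances of resolvent iterates it gives Kobayashi's estimate,
  hence the exponential formula, and more generally that \<open>J\<^bsub>t/k\<^esub>\<^bsup>m\<^esup> x\<close> tends to \<open>S(s) x\<close>
  when \<open>m t/k\<close> tends to \<open>s\<close>. The latter shows that the distance of the orbit to a
  stationary point never increases, and Opial's argument, based on the existence of
  \<open>\<Delta>\<close>-convergent subsequences of bounded sequences, gives the \<open>\<Delta>\<close>-convergence.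
\<close>

section \<open>Comparison triangles\<close>

lemma geodesics_dist:
  assumes "\<gamma> \<in> geodesics" "s \<in> {0..1}" "t \<in> {0..1}"
  shows "dist (\<gamma> s) (\<gamma> t) = dist (\<gamma> 0) (\<gamma> 1) * \<bar>s - t\<bar>"
  using assms unfolding geodesics_def by blast

text \<open>The law of cosines. With division by zero equal to 0, the value at \<open>q = p\<close>
  or \<open>r = p\<close> is 0, so the product form below holds without side conditions.\<close>

definition comparison_cos :: "'a::metric_space \<Rightarrow> 'a \<Rightarrow> 'a \<Rightarrow> real" where
  "comparison_cos p q r =
     ((dist p q)\<^sup>2 + (dist p r)\<^sup>2 - (dist q r)\<^sup>2) / (2 * dist p q * dist p r)"

lemma comparison_cos_mult:
  "2 * dist p q * dist p r * comparison_cos p q r = (dist p q)\<^sup>2 + (dist p r)\<^sup>2 - (dist q r)\<^sup>2"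
  by (cases "q = p"; cases "r = p") (auto simp: comparison_cos_def dist_commute)

text \<open>The triangle inequalities say that the third side lies between the difference and the
  sum of the other two; squaring gives the bound.\<close>

lemma comparison_cos_bounds: "\<bar>comparison_cos p q r\<bar> \<le> 1"
proof (cases "q = p \<or> r = p")
  case True
  then show ?thesis by (auto simp: comparison_cos_def)
next
  case False
  define a b c where "a = dist p q" and "b = dist p r" and "c = dist q r"
  have pos: "a > 0" "b > 0" using False by (auto simp: a_def b_def)
  have "c \<le> a + b" "a \<le> b + c" "b \<le> a + c" "c \<ge> 0"
    unfolding a_def b_def c_def using dist_triangle[of q r p] dist_triangle[of p q r]
      dist_triangle[of p r q] by (auto simp: dist_commute)
  then have "c\<^sup>2 \<le> (a + b)\<^sup>2" "(a - b)\<^sup>2 \<le> c\<^sup>2"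
    using pos by (auto intro!: power_mono simp: abs_le_square_iff[symmetric])
  then have "\<bar>a\<^sup>2 + b\<^sup>2 - c\<^sup>2\<bar> \<le> 2 * a * b"
    by (auto simp: power2_sum power2_diff abs_le_iff)
  then show ?thesis
    using pos by (simp add: comparison_cos_def a_def[symmetric] b_def[symmetric] c_def[symmetric] abs_mult)
qed

lemma comparison_triangle_inner:
  assumes "comparison_triangle p q r p' q' r'"
  shows "2 * ((q' - p') \<bullet> (r' - p')) = (dist p q)\<^sup>2 + (dist p r)\<^sup>2 - (dist q r)\<^sup>2"
proof -
  have "(norm (q' - r'))\<^sup>2 = (norm (q' - p'))\<^sup>2 + (norm (r' - p'))\<^sup>2 - 2 * ((q' - p') \<bullet> (r' - p'))"
    by (simp add: power2_norm_eq_inner inner_diff inner_commute)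
  moreover have "norm (q' - r') = dist q r" "norm (q' - p') = dist p q" "norm (r' - p') = dist p r"
    using assms by (auto simp: comparison_triangle_def dist_norm norm_minus_commute)
  ultimately show ?thesis by simp
qed

text \<open>The vertex \<open>p'\<close> is put at the origin, \<open>q'\<close> on the real axis,
  and \<open>r'\<close> at the angle \<theta> prescribed by the law of cosines. The bound on
  \<open>comparison_cos\<close> ensures that \<theta> really has this cosine.\<close>

lemma comparison_triangle_exists: "\<exists>p' q' r'. comparison_triangle p q r p' q' r'"
proof -
  define \<theta> where "\<theta> = arccos (comparison_cos p q r)"
  let ?q = "complex_of_real (dist p q)" and ?r = "of_real (dist p r) * cis \<theta>"
  have c: "cos \<theta> = comparison_cos p q r"
    unfolding \<theta>_def using comparison_cos_bounds[of p q r] by (intro cos_arccos) auto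
  have "(norm (?q - ?r))\<^sup>2 = (dist p q - dist p r * cos \<theta>)\<^sup>2 + (dist p r * sin \<theta>)\<^sup>2"
    by (simp add: cmod_power2)
  also have "\<dots> = (dist p q)\<^sup>2 - 2 * dist p q * dist p r * cos \<theta> + (dist p r)\<^sup>2 * ((cos \<theta>)\<^sup>2 + (sin \<theta>)\<^sup>2)"
    by algebra
  also have "\<dots> = (dist q r)\<^sup>2"
    using comparison_cos_mult[of p q r] sin_cos_squared_add2[of \<theta>] by (simp add: c[symmetric])
  finally have "norm (?q - ?r) = dist q r"
    by simp
  then have "comparison_triangle p q r 0 ?q ?r"
    by (simp add: comparison_triangle_def dist_norm norm_mult)
  then show ?thesis by blast
qed

text \<open>The angle of a Euclidean triangle depends on its side lengths only, so all comparison
  triangles agree and the definite description in \<open>comparison_angle\<close> is proper.\<close>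

lemma comparison_angle_eq_arccos:
  assumes "q \<noteq> p" "r \<noteq> p"
  shows "comparison_angle p q r = arccos (comparison_cos p q r)"
proof -
  have *: "euclidean_angle p' q' r' = arccos (comparison_cos p q r)"
    if "comparison_triangle p q r p' q' r'" for p' q' r'
  proof -
    have "norm (q' - p') = dist p q" "norm (r' - p') = dist p r"
      using that by (auto simp: comparison_triangle_def dist_norm norm_minus_commute)
    then show ?thesis
      by (simp add: euclidean_angle_def comparison_cos_def comparison_triangle_inner[OF that, symmetric])
  qed
  obtain p' q' r' where "comparison_triangle p q r p' q' r'"
    using comparison_triangle_exists by blast
  with * have "(THE \<theta>. \<exists>p' q' r'. comparison_triangle p q r p' q' r' \<and> \<theta> = euclidean_angle p' q' r')
      = arccos (comparison_cos p q r)"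
    by (intro the_equality) metis+
  then show ?thesis using assms by (simp add: comparison_angle_def)
qed

section \<open>Quadratic inequalities in CAT(0) spaces\<close>

text \<open>The comparison axiom with the plane eliminated: the comparison distance is expanded
  through the inner product of the two sides. Every later use of the axiom passes through this
  form.\<close>

lemma cat0_quadratic_comparison:
  fixes \<gamma> \<delta> :: "real \<Rightarrow> 'a::cat0_space"
  assumes "\<gamma> \<in> geodesics_from p" "\<delta> \<in> geodesics_from p" "s \<in> {0..1}" "t \<in> {0..1}"
  shows "(dist (\<gamma> s) (\<delta> t))\<^sup>2 \<le> s\<^sup>2 * (dist p (\<gamma> 1))\<^sup>2 + t\<^sup>2 * (dist p (\<delta> 1))\<^sup>2
    - s * t * ((dist p (\<gamma> 1))\<^sup>2 + (dist p (\<delta> 1))\<^sup>2 - (dist (\<gamma> 1) (\<delta> 1))\<^sup>2)"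
proof -
  obtain p' q' r' where tri: "comparison_triangle p (\<gamma> 1) (\<delta> 1) p' q' r'"
    using comparison_triangle_exists by blast
  define u v where "u = q' - p'" and "v = r' - p'"
  have nrm: "norm u = dist p (\<gamma> 1)" "norm v = dist p (\<delta> 1)"
    using tri by (auto simp: comparison_triangle_def u_def v_def dist_norm norm_minus_commute)
  have inn: "2 * (u \<bullet> v) = (dist p (\<gamma> 1))\<^sup>2 + (dist p (\<delta> 1))\<^sup>2 - (dist (\<gamma> 1) (\<delta> 1))\<^sup>2"
    using comparison_triangle_inner[OF tri] by (simp add: u_def v_def)
  have "dist (\<gamma> s) (\<delta> t) \<le> dist (p' + s *\<^sub>R (q' - p')) (p' + t *\<^sub>R (r' - p'))"
    using assms tri by (intro cat0_comparison) (auto simp: geodesics_from_def)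
  also have "\<dots> = norm (s *\<^sub>R u - t *\<^sub>R v)"
    by (simp add: dist_norm u_def v_def)
  finally have "(dist (\<gamma> s) (\<delta> t))\<^sup>2 \<le> (norm (s *\<^sub>R u - t *\<^sub>R v))\<^sup>2"
    by (intro power_mono) auto
  also have "\<dots> = s\<^sup>2 * (norm u)\<^sup>2 + t\<^sup>2 * (norm v)\<^sup>2 - s * t * (2 * (u \<bullet> v))"
    by (simp add: power2_norm_eq_inner inner_diff inner_commute power2_eq_square[of s] power2_eq_square[of t])
  finally show ?thesis by (simp only: nrm inn)
qed

text \<open>Two geodesics with the same end points span a degenerate triangle, in which the
  comparison points at equal times coincide.\<close>

lemma geodesic_unique:
  fixes \<gamma> \<delta> :: "real \<Rightarrow> 'a::cat0_space"
  assumes "\<gamma> \<in> geodesics" "\<delta> \<in> geodesics" "\<gamma> 0 = \<delta> 0" "\<gamma> 1 = \<delta> 1"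
  shows "\<gamma> = \<delta>"
proof (rule extensionalityI)
  show "\<gamma> \<in> extensional {0..1}" "\<delta> \<in> extensional {0..1}"
    using assms unfolding geodesics_def by blast+
  fix s :: real assume s: "s \<in> {0..1}"
  have "(dist (\<gamma> s) (\<delta> s))\<^sup>2 \<le> 0"
    using cat0_quadratic_comparison[of \<gamma> "\<gamma> 0" \<delta> s s] assms s
    by (simp add: geodesics_from_def algebra_simps power2_eq_square)
  then show "\<gamma> s = \<delta> s" by simp
qed

lemma geodesic_props:
  fixes x y :: "'a::cat0_space"
  shows "geodesic x y \<in> geodesics" "geodesic x y 0 = x" "geodesic x y 1 = y"
    and geodesic_in_geodesics_from: "geodesic x y \<in> geodesics_from x"
proof -
  have "\<exists>!\<gamma>. \<gamma> \<in> geodesics \<and> \<gamma> 0 = x \<and> \<gamma> 1 = y"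
    using geodesic_exists[of x y] geodesic_unique by metis
  from theI'[OF this] show "geodesic x y \<in> geodesics" "geodesic x y 0 = x" "geodesic x y 1 = y"
    by (auto simp: geodesic_def)
  then show "geodesic x y \<in> geodesics_from x" by (simp add: geodesics_from_def)
qed

text \<open>Comparison of the time 1/2 on the side from \<open>y\<close> to \<open>z\<close> with
  the end point of the side from \<open>y\<close> to \<open>x\<close>. This is the CN inequality of
  Bruhat and Tits.\<close>

lemma Bruhat_Tits_midpoint:
  fixes y z :: "'a::cat0_space"
  obtains m where "\<And>x. (dist m x)\<^sup>2 \<le> ((dist y x)\<^sup>2 + (dist z x)\<^sup>2) / 2 - (dist y z)\<^sup>2 / 4"
proof
  fix x
  show "(dist (geodesic y z (1/2)) x)\<^sup>2 \<le> ((dist y x)\<^sup>2 + (dist z x)\<^sup>2) / 2 - (dist y z)\<^sup>2 / 4"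
    using cat0_quadratic_comparison[OF geodesic_in_geodesics_from[of y z]
        geodesic_in_geodesics_from[of y x], of "1/2" 1]
    by (simp add: geodesic_props power2_eq_square field_simps)
qed

text \<open>The diagonal from \<open>y\<close> to \<open>z\<close> is estimated through the midpoint
  of the other diagonal, whose distances to \<open>y\<close> and \<open>z\<close> are controlled by
  the CN inequality.\<close>

lemma cat0_quadrilateral:
  fixes x y z w :: "'a::cat0_space"
  shows "(dist x w)\<^sup>2 + (dist y z)\<^sup>2 \<le> (dist x y)\<^sup>2 + (dist y w)\<^sup>2 + (dist w z)\<^sup>2 + (dist z x)\<^sup>2"
proof -
  obtain m where m: "\<And>v. (dist m v)\<^sup>2 \<le> ((dist x v)\<^sup>2 + (dist w v)\<^sup>2) / 2 - (dist x w)\<^sup>2 / 4"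
    using Bruhat_Tits_midpoint[of x w] by blast
  have "(dist y z)\<^sup>2 \<le> (dist m y + dist m z)\<^sup>2"
    by (intro power_mono) (auto simp: dist_triangle3)
  also have "\<dots> \<le> 2 * (dist m y)\<^sup>2 + 2 * (dist m z)\<^sup>2"
    using sum_squares_ge_zero[of "dist m y - dist m z" 0] by (simp add: power2_eq_square algebra_simps)
  finally show ?thesis using m[of y] m[of z] by (simp add: dist_commute field_simps)
qed

section \<open>Angles and the inner product of tangent vectors\<close>

lemma geodesics_from_props:
  assumes "\<gamma> \<in> geodesics_from p"
  shows "\<gamma> \<in> geodesics" "\<gamma> 0 = p" "t \<in> {0..1} \<Longrightarrow> dist p (\<gamma> t) = t * dist p (\<gamma> 1)"
  using assms geodesics_dist[of \<gamma> 0 t] by (auto simp: geodesics_from_def)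

section \<open>Monotonicity of comparison angles and existence of Alexandrov angles\<close>

text \<open>Makes the comparison inequality, which concerns triangles spanned by end points,
  available for triangles with vertices at interior times.\<close>

lemma geodesics_from_shrink:
  assumes \<gamma>: "\<gamma> \<in> geodesics_from p" and c: "c \<in> {0..1}"
  shows "restrict (\<lambda>u. \<gamma> (c * u)) {0..1} \<in> geodesics_from p"
proof -
  have in01: "c * u \<in> {0..1}" if "u \<in> {0..1}" for u
    using c that by (auto intro: mult_le_one)
  have "dist (\<gamma> (c * s)) (\<gamma> (c * t)) = dist (\<gamma> (c * 0)) (\<gamma> (c * 1)) * \<bar>s - t\<bar>"
    if st: "s \<in> {0..1}" "t \<in> {0..1}" for s t
  proof -
    have "dist (\<gamma> (c * s)) (\<gamma> (c * t)) = dist (\<gamma> 0) (\<gamma> 1) * \<bar>c * s - c * t\<bar>"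
      using geodesics_from_props(1)[OF \<gamma>] in01 st by (intro geodesics_dist) auto
    moreover have "dist (\<gamma> (c * 0)) (\<gamma> (c * 1)) = dist (\<gamma> 0) (\<gamma> 1) * \<bar>c * 0 - c * 1\<bar>"
      using geodesics_from_props(1)[OF \<gamma>] c by (intro geodesics_dist) auto
    moreover have "\<bar>c * s - c * t\<bar> = c * \<bar>s - t\<bar>"
      using c by (simp add: abs_mult flip: right_diff_distrib)
    ultimately show ?thesis using c by simp
  qed
  then show ?thesis
    using geodesics_from_props(2)[OF \<gamma>] by (simp add: geodesics_from_def geodesics_def)
qed

text \<open>Comparison in the triangle with vertices \<open>p\<close>, \<open>\<gamma> s'\<close>,
  \<open>\<delta> t'\<close> at the relative times \<sigma> and \<tau>; division by
  \<open>\<sigma> * \<tau> * (2 * a * b)\<close> turns the quadratic inequality into one between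
  cosines. Comparison angles thus decrease towards the vertex.\<close>

lemma comparison_cos_mono:
  fixes \<gamma> \<delta> :: "real \<Rightarrow> 'a::cat0_space"
  assumes \<gamma>: "\<gamma> \<in> geodesics_from p" "\<gamma> 1 \<noteq> p" and \<delta>: "\<delta> \<in> geodesics_from p" "\<delta> 1 \<noteq> p"
    and s: "0 < s" "s \<le> s'" "s' \<le> 1" and t: "0 < t" "t \<le> t'" "t' \<le> 1"
  shows "comparison_cos p (\<gamma> s') (\<delta> t') \<le> comparison_cos p (\<gamma> s) (\<delta> t)"
proof -
  define \<sigma> \<tau> a b where "\<sigma> = s / s'" and "\<tau> = t / t'"
    and "a = dist p (\<gamma> s')" and "b = dist p (\<delta> t')"
  have st: "0 < \<sigma>" "\<sigma> \<le> 1" "0 < \<tau>" "\<tau> \<le> 1" "s' * \<sigma> = s" "t' * \<tau> = t"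
    using s t by (auto simp: \<sigma>_def \<tau>_def)
  have ab: "a > 0" "b > 0" "dist p (\<gamma> s) = \<sigma> * a" "dist p (\<delta> t) = \<tau> * b"
    using geodesics_from_props(3)[OF \<gamma>(1), of s] geodesics_from_props(3)[OF \<delta>(1), of t]
      geodesics_from_props(3)[OF \<gamma>(1), of s'] geodesics_from_props(3)[OF \<delta>(1), of t'] \<gamma>(2) \<delta>(2) s t
    by (simp_all add: a_def b_def \<sigma>_def \<tau>_def)
  have le: "(dist (\<gamma> s) (\<delta> t))\<^sup>2 \<le> \<sigma>\<^sup>2 * a\<^sup>2 + \<tau>\<^sup>2 * b\<^sup>2
      - \<sigma> * \<tau> * (a\<^sup>2 + b\<^sup>2 - (dist (\<gamma> s') (\<delta> t'))\<^sup>2)"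
    using cat0_quadratic_comparison[OF geodesics_from_shrink[OF \<gamma>(1), of s']
        geodesics_from_shrink[OF \<delta>(1), of t'], of \<sigma> \<tau>] s t st
    by (simp add: a_def b_def)
  have "comparison_cos p (\<gamma> s') (\<delta> t')
      = (\<sigma> * \<tau> * (a\<^sup>2 + b\<^sup>2 - (dist (\<gamma> s') (\<delta> t'))\<^sup>2)) / (\<sigma> * \<tau> * (2 * a * b))"
    using st ab by (simp add: comparison_cos_def a_def b_def)
  also have "\<dots> \<le> (\<sigma>\<^sup>2 * a\<^sup>2 + \<tau>\<^sup>2 * b\<^sup>2 - (dist (\<gamma> s) (\<delta> t))\<^sup>2) / (\<sigma> * \<tau> * (2 * a * b))"
    using le st ab by (intro divide_right_mono) auto
  also have "\<dots> = comparison_cos p (\<gamma> s) (\<delta> t)"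
    by (simp add: comparison_cos_def ab power_mult_distrib mult_ac)
  finally show ?thesis .
qed

lemma prod_at_right_0_nontrivial: "at_right 0 \<times>\<^sub>F at_right 0 \<noteq> (bot :: (real \<times> real) filter)"
  by (simp add: prod_filter_eq_bot)

lemma eventually_prod_at_right_0:
  fixes s t :: real
  assumes "s > 0" "t > 0"
  shows "eventually (\<lambda>z. fst z \<in> {0<..<s} \<and> snd z \<in> {0<..<t}) (at_right 0 \<times>\<^sub>F at_right 0)"
  unfolding eventually_prod_filter
  using assms by (intro exI[of _ "\<lambda>u. u \<in> {0<..<s}"] exI[of _ "\<lambda>u. u \<in> {0<..<t}"])
    (auto simp: eventually_at_right_field)

text \<open>By monotonicity the cosines converge to their supremum over positive times up to 1, so
  the limit defining the angle exists. The pair of times \<open>(1, 1)\<close> takes part in this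
  supremum, hence the Alexandrov angle is at most the comparison angle.\<close>

lemma alexandrov_angle_tendsto:
  fixes \<gamma> \<delta> :: "real \<Rightarrow> 'a::cat0_space"
  assumes \<gamma>: "\<gamma> \<in> geodesics_from p" "\<gamma> 1 \<noteq> p" and \<delta>: "\<delta> \<in> geodesics_from p" "\<delta> 1 \<noteq> p"
  shows comparison_cos_tendsto: "((\<lambda>(s, t). comparison_cos p (\<gamma> s) (\<delta> t)) \<longlongrightarrow>
      cos (alexandrov_angle p \<gamma> \<delta>)) (at_right 0 \<times>\<^sub>F at_right 0)"
    and alexandrov_angle_bounds: "alexandrov_angle p \<gamma> \<delta> \<in> {0..pi}"
    and comparison_cos_le_cos_alexandrov_angle:
      "comparison_cos p (\<gamma> 1) (\<delta> 1) \<le> cos (alexandrov_angle p \<gamma> \<delta>)"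
proof -
  define C where "C = (\<lambda>(s, t). comparison_cos p (\<gamma> s) (\<delta> t))"
  define D :: "(real \<times> real) set" where "D = {0<..1} \<times> {0<..1}"
  define L where "L = (SUP z\<in>D. C z)"
  let ?F = "at_right 0 \<times>\<^sub>F at_right 0 :: (real \<times> real) filter"
  have bnd: "\<bar>C z\<bar> \<le> 1" for z
    by (auto simp: C_def comparison_cos_bounds split: prod.split)
  have bdd: "bdd_above (C ` D)"
    using bnd by (intro bdd_aboveI[of _ 1]) (auto simp: abs_le_iff)
  have le_L: "C z \<le> L" if "z \<in> D" for z
    unfolding L_def using that bdd by (rule cSUP_upper)
  have lim: "(C \<longlongrightarrow> L) ?F"
  proof (rule order_tendstoI)
    fix a assume "a < L"
    then obtain z where z: "z \<in> D" "a < C z"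
      using less_cSUP_iff[of D C a] bdd by (auto simp: L_def D_def)
    obtain s t where st: "z = (s, t)" "0 < s" "s \<le> 1" "0 < t" "t \<le> 1"
      using z(1) by (auto simp: D_def)
    show "eventually (\<lambda>z. a < C z) ?F"
      using eventually_prod_at_right_0[OF st(2,4)]
    proof eventually_elim
      case (elim w)
      then have "C z \<le> C w"
        using st by (auto simp: C_def split_beta intro!: comparison_cos_mono assms)
      with z show ?case by simp
    qed
  next
    fix a assume "L < a"
    show "eventually (\<lambda>z. C z < a) ?F"
      using eventually_prod_at_right_0[of 1 1, simplified]
    proof eventually_elim
      case (elim w)
      then have "C w \<le> L" by (intro le_L) (auto simp: D_def mem_Times_iff)
      with \<open>L < a\<close> show ?case by simp
    qed
  qed
  have L: "L \<in> {-1..1}"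
    using lim bnd unfolding atLeastAtMost_iff
    by (auto intro!: tendsto_lowerbound[OF lim] tendsto_upperbound[OF lim] prod_at_right_0_nontrivial
        always_eventually simp: abs_le_iff minus_le_iff)
  have ne: "\<gamma> s \<noteq> p" "\<delta> s \<noteq> p" if "0 < s" "s \<le> 1" for s
    using geodesics_from_props(3)[OF \<gamma>(1), of s] geodesics_from_props(3)[OF \<delta>(1), of s] assms that
    by auto
  have "((\<lambda>z. arccos (C z)) \<longlongrightarrow> arccos L) ?F"
    using L bnd by (intro continuous_on_tendsto_compose[OF continuous_on_arccos' lim])
      (auto simp: abs_le_iff minus_le_iff)
  moreover have "eventually (\<lambda>z. arccos (C z) = (\<lambda>(s, t). comparison_angle p (\<gamma> s) (\<delta> t)) z) ?F"
    using eventually_prod_at_right_0[of 1 1, simplified]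
    by eventually_elim (auto simp: C_def split_beta ne comparison_angle_eq_arccos)
  ultimately have "((\<lambda>(s, t). comparison_angle p (\<gamma> s) (\<delta> t)) \<longlongrightarrow> arccos L) ?F"
    by (rule Lim_transform_eventually)
  then have angle: "alexandrov_angle p \<gamma> \<delta> = arccos L"
    unfolding alexandrov_angle_def by (intro tendsto_Lim prod_at_right_0_nontrivial)
  show "((\<lambda>(s, t). comparison_cos p (\<gamma> s) (\<delta> t)) \<longlongrightarrow> cos (alexandrov_angle p \<gamma> \<delta>)) ?F"
    using lim L by (simp add: C_def angle cos_arccos)
  show "alexandrov_angle p \<gamma> \<delta> \<in> {0..pi}"
    using L by (simp add: angle arccos_lbound arccos_ubound)
  show "comparison_cos p (\<gamma> 1) (\<delta> 1) \<le> cos (alexandrov_angle p \<gamma> \<delta>)"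
    using le_L[of "(1, 1)"] L by (simp add: C_def D_def angle cos_arccos)
qed

section \<open>Angles as limits of chord ratios\<close>

text \<open>Evaluating two geodesics at the same distance from the vertex expresses their angle by a
  chord length, to which the triangle inequality applies. Meaningful only for \<epsilon> between 0
  and the length of a nonzero geodesic.\<close>

definition unit_speed :: "(real \<Rightarrow> 'a::metric_space) \<Rightarrow> real \<Rightarrow> 'a" where
  "unit_speed \<gamma> \<epsilon> = \<gamma> (\<epsilon> / dist (\<gamma> 0) (\<gamma> 1))"

text \<open>An isosceles triangle with legs \<epsilon> and comparison cosine \<open>c\<close> has
  base \<open>\<epsilon> * sqrt (2 - 2 * c)\<close>. The double limit of the cosines is taken along
  the path \<open>(\<epsilon> / a, \<epsilon> / b)\<close>.\<close>

lemma unit_speed_tendsto: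
  fixes \<gamma> \<delta> :: "real \<Rightarrow> 'a::cat0_space"
  assumes \<gamma>: "\<gamma> \<in> geodesics_from p" "\<gamma> 1 \<noteq> p" and \<delta>: "\<delta> \<in> geodesics_from p" "\<delta> 1 \<noteq> p"
  shows "((\<lambda>\<epsilon>. dist (unit_speed \<gamma> \<epsilon>) (unit_speed \<delta> \<epsilon>) / \<epsilon>) \<longlongrightarrow>
    sqrt (2 - 2 * cos (alexandrov_angle p \<gamma> \<delta>))) (at_right 0)"
proof -
  define a b where "a = dist p (\<gamma> 1)" and "b = dist p (\<delta> 1)"
  define e where "e = (\<lambda>\<epsilon>. dist (unit_speed \<gamma> \<epsilon>) (unit_speed \<delta> \<epsilon>) / \<epsilon>)"
  have ab: "a > 0" "b > 0" using assms by (auto simp: a_def b_def)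
  have us: "unit_speed \<gamma> \<epsilon> = \<gamma> (\<epsilon> / a)" "unit_speed \<delta> \<epsilon> = \<delta> (\<epsilon> / b)" for \<epsilon>
    using geodesics_from_props(2) assms by (auto simp: unit_speed_def a_def b_def)
  have "filterlim (\<lambda>\<epsilon>. (\<epsilon> / a, \<epsilon> / b)) (at_right 0 \<times>\<^sub>F at_right 0) (at_right 0)"
    using filterlim_times_pos[OF filterlim_ident, of "inverse a" 0 0] filterlim_times_pos[OF filterlim_ident, of "inverse b" 0 0] ab
    by (intro filterlim_Pair) (simp_all add: divide_inverse mult.commute)
  from filterlim_compose[OF comparison_cos_tendsto[OF assms] this]
  have "((\<lambda>\<epsilon>. comparison_cos p (\<gamma> (\<epsilon> / a)) (\<delta> (\<epsilon> / b))) \<longlongrightarrow> cos (alexandrov_angle p \<gamma> \<delta>)) (at_right 0)"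
    by simp
  then have "((\<lambda>\<epsilon>. sqrt (2 - 2 * comparison_cos p (\<gamma> (\<epsilon> / a)) (\<delta> (\<epsilon> / b))))
      \<longlongrightarrow> sqrt (2 - 2 * cos (alexandrov_angle p \<gamma> \<delta>))) (at_right 0)"
    by (intro tendsto_intros)
  moreover have "eventually (\<lambda>\<epsilon>. sqrt (2 - 2 * comparison_cos p (\<gamma> (\<epsilon> / a)) (\<delta> (\<epsilon> / b))) = e \<epsilon>) (at_right 0)"
  proof -
    have "eventually (\<lambda>\<epsilon>. \<epsilon> \<in> {0<..<min a b}) (at_right 0)"
      using ab by (intro eventually_at_right_real) auto
    then show ?thesis
    proof eventually_elim
      case (elim \<epsilon>)
      have "dist p (\<gamma> (\<epsilon> / a)) = \<epsilon>" "dist p (\<delta> (\<epsilon> / b)) = \<epsilon>"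
        using elim ab geodesics_from_props(3)[OF \<gamma>(1), of "\<epsilon> / a"]
          geodesics_from_props(3)[OF \<delta>(1), of "\<epsilon> / b"]
        by (auto simp: a_def[symmetric] b_def[symmetric])
      then have "2 - 2 * comparison_cos p (\<gamma> (\<epsilon> / a)) (\<delta> (\<epsilon> / b)) = (e \<epsilon>)\<^sup>2"
        using elim by (simp add: e_def us comparison_cos_def power_divide field_simps power2_eq_square)
      moreover have "e \<epsilon> \<ge> 0" using elim by (simp add: e_def)
      ultimately show ?case by simp
    qed
  qed
  ultimately show ?thesis unfolding e_def[symmetric] by (rule Lim_transform_eventually)
qed

text \<open>Angle 0 means that the chords between the two geodesics are o(\<epsilon>), so exchanging
  one for the other changes chord ratios by a null quantity. This makes angles between directions
  well defined.\<close>

lemma alexandrov_angle_cong: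
  fixes \<gamma> \<delta> :: "real \<Rightarrow> 'a::cat0_space"
  assumes \<gamma>: "\<gamma> \<in> geodesics_from p" "\<gamma> 1 \<noteq> p" and \<delta>: "\<delta> \<in> geodesics_from p" "\<delta> 1 \<noteq> p"
    and \<gamma>': "\<gamma>' \<in> geodesics_from p" "\<gamma>' 1 \<noteq> p" and \<delta>': "\<delta>' \<in> geodesics_from p" "\<delta>' 1 \<noteq> p"
    and "alexandrov_angle p \<gamma> \<gamma>' = 0" "alexandrov_angle p \<delta> \<delta>' = 0"
  shows "alexandrov_angle p \<gamma>' \<delta>' = alexandrov_angle p \<gamma> \<delta>"
proof -
  let ?e = "\<lambda>\<gamma> \<delta> \<epsilon>. dist (unit_speed \<gamma> \<epsilon>) (unit_speed \<delta> \<epsilon> :: 'a) / \<epsilon>"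
  have zero: "((\<lambda>\<epsilon>. ?e \<gamma> \<gamma>' \<epsilon> + ?e \<delta> \<delta>' \<epsilon>) \<longlongrightarrow> 0) (at_right 0)"
    using tendsto_add[OF unit_speed_tendsto[OF \<gamma> \<gamma>'] unit_speed_tendsto[OF \<delta> \<delta>']] assms by simp
  have "((\<lambda>\<epsilon>. ?e \<gamma> \<delta> \<epsilon> - ?e \<gamma>' \<delta>' \<epsilon>) \<longlongrightarrow> 0) (at_right 0)"
  proof (rule Lim_null_comparison[OF _ zero])
    have "eventually (\<lambda>\<epsilon>::real. \<epsilon> > 0) (at_right 0)"
      by (simp add: eventually_at_right_less)
    then show "eventually (\<lambda>\<epsilon>. norm (?e \<gamma> \<delta> \<epsilon> - ?e \<gamma>' \<delta>' \<epsilon>) \<le> ?e \<gamma> \<gamma>' \<epsilon> + ?e \<delta> \<delta>' \<epsilon>) (at_right 0)"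
    proof eventually_elim
      case (elim \<epsilon>)
      have "\<bar>dist (unit_speed \<gamma> \<epsilon>) (unit_speed \<delta> \<epsilon>) - dist (unit_speed \<gamma>' \<epsilon>) (unit_speed \<delta>' \<epsilon>)\<bar>
          \<le> dist (unit_speed \<gamma> \<epsilon>) (unit_speed \<gamma>' \<epsilon>) + dist (unit_speed \<delta> \<epsilon>) (unit_speed \<delta>' \<epsilon>)"
        by metric
      then show ?case
        using elim by (simp add: divide_right_mono flip: diff_divide_distrib add_divide_distrib)
    qed
  qed
  moreover have "((\<lambda>\<epsilon>. ?e \<gamma> \<delta> \<epsilon> - ?e \<gamma>' \<delta>' \<epsilon>) \<longlongrightarrow>
      sqrt (2 - 2 * cos (alexandrov_angle p \<gamma> \<delta>)) - sqrt (2 - 2 * cos (alexandrov_angle p \<gamma>' \<delta>'))) (at_right 0)"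
    by (intro tendsto_diff unit_speed_tendsto assms)
  ultimately have "cos (alexandrov_angle p \<gamma>' \<delta>') = cos (alexandrov_angle p \<gamma> \<delta>)"
    using tendsto_unique[OF trivial_limit_at_right_real] by fastforce
  then show ?thesis
    using alexandrov_angle_bounds[OF \<gamma> \<delta>] alexandrov_angle_bounds[OF \<gamma>' \<delta>']
    by (metis arccos_cos atLeastAtMost_iff)
qed

text \<open>For a zero geodesic the convention that the comparison angle of \<open>p, p\<close> at
  \<open>p\<close> is 0 decides; otherwise the chord ratios vanish identically.\<close>

lemma alexandrov_angle_self:
  fixes \<gamma> :: "real \<Rightarrow> 'a::cat0_space"
  assumes \<gamma>: "\<gamma> \<in> geodesics_from p"
  shows "alexandrov_angle p \<gamma> \<gamma> = 0"
proof (cases "\<gamma> 1 = p")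
  case True
  have "eventually (\<lambda>z. 0 = (\<lambda>(s, t). comparison_angle p (\<gamma> s) (\<gamma> t)) z) (at_right 0 \<times>\<^sub>F at_right 0)"
    using eventually_prod_at_right_0[OF zero_less_one zero_less_one]
  proof eventually_elim
    case (elim z)
    then have "dist p (\<gamma> (fst z)) = 0" "dist p (\<gamma> (snd z)) = 0"
      using True geodesics_from_props(3)[OF \<gamma>, of "fst z"] geodesics_from_props(3)[OF \<gamma>, of "snd z"]
      by auto
    then show ?case by (simp add: comparison_angle_def split_beta)
  qed
  then have "((\<lambda>(s, t). comparison_angle p (\<gamma> s) (\<gamma> t)) \<longlongrightarrow> 0) (at_right 0 \<times>\<^sub>F at_right 0)"
    by (rule Lim_transform_eventually[OF tendsto_const])
  then show ?thesis
    unfolding alexandrov_angle_def by (intro tendsto_Lim prod_at_right_0_nontrivial)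
next
  case False
  have "((\<lambda>\<epsilon>::real. 0) \<longlongrightarrow> sqrt (2 - 2 * cos (alexandrov_angle p \<gamma> \<gamma>))) (at_right 0)"
    using unit_speed_tendsto[OF \<gamma> False \<gamma> False] by simp
  then have "cos (alexandrov_angle p \<gamma> \<gamma>) = cos 0"
    using tendsto_unique[OF trivial_limit_at_right_real tendsto_const] by fastforce
  then show ?thesis
    using alexandrov_angle_bounds[OF \<gamma> False \<gamma> False] by (metis arccos_cos atLeastAtMost_iff order.refl pi_ge_zero)
qed

text \<open>The conventional value \<open>pi / 2\<close> is constant along the limit. Since it is
  not 0, zero geodesics are never identified with nonzero ones.\<close>

lemma alexandrov_angle_zero_geodesic:
  fixes \<gamma> \<delta> :: "real \<Rightarrow> 'a::cat0_space"
  assumes \<gamma>: "\<gamma> \<in> geodesics_from p" and \<delta>: "\<delta> \<in> geodesics_from p"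
    and "(\<gamma> 1 = p) \<noteq> (\<delta> 1 = p)"
  shows "alexandrov_angle p \<gamma> \<delta> = pi / 2"
proof -
  have "eventually (\<lambda>z. pi / 2 = (\<lambda>(s, t). comparison_angle p (\<gamma> s) (\<delta> t)) z) (at_right 0 \<times>\<^sub>F at_right 0)"
    using eventually_prod_at_right_0[OF zero_less_one zero_less_one]
  proof eventually_elim
    case (elim z)
    then have "dist p (\<gamma> (fst z)) = fst z * dist p (\<gamma> 1)" "dist p (\<delta> (snd z)) = snd z * dist p (\<delta> 1)"
      by (auto intro!: geodesics_from_props(3) assms)
    then show ?case
      using elim assms(3) by (auto simp: comparison_angle_def split_beta)
  qed
  then have "((\<lambda>(s, t). comparison_angle p (\<gamma> s) (\<delta> t)) \<longlongrightarrow> pi / 2) (at_right 0 \<times>\<^sub>F at_right 0)"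
    by (rule Lim_transform_eventually[OF tendsto_const])
  then show ?thesis
    unfolding alexandrov_angle_def by (intro tendsto_Lim prod_at_right_0_nontrivial)
qed

section \<open>The inner product of tangent vectors\<close>

lemma direction_rel_self: "\<gamma> \<in> geodesics_from p \<Longrightarrow> \<gamma> \<in> direction_rel p `` {\<gamma>}"
  for p :: "'a::cat0_space"
  by (simp add: direction_rel_def alexandrov_angle_self)

text \<open>A direction consists of zero geodesics only or contains none, because a mixed pair has
  angle \<open>pi / 2\<close>.\<close>

lemma direction_zeta_class:
  fixes p :: "'a::cat0_space"
  assumes \<gamma>: "\<gamma> \<in> geodesics_from p"
  shows "direction_zeta (direction_rel p `` {\<gamma>}) = (if \<gamma> 1 = p then 0 else 1)"
proof -
  define k :: real where "k = (if \<gamma> 1 = p then 0 else 1)"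
  have "zeta \<gamma>' = k" if "\<gamma>' \<in> direction_rel p `` {\<gamma>}" for \<gamma>'
  proof -
    have "\<gamma>' \<in> geodesics_from p" "alexandrov_angle p \<gamma> \<gamma>' = 0"
      using that by (auto simp: direction_rel_def)
    then have "\<gamma>' 0 = p" "\<gamma>' 1 = p \<longleftrightarrow> \<gamma> 1 = p"
      using alexandrov_angle_zero_geodesic[OF \<gamma>, of \<gamma>'] geodesics_from_props(2)[of \<gamma>' p] by auto
    then have "\<gamma>' 0 = \<gamma>' 1 \<longleftrightarrow> \<gamma> 1 = p" by metis
    then show ?thesis by (simp only: zeta_def k_def)
  qed
  then show ?thesis
    unfolding direction_zeta_def k_def[symmetric] using direction_rel_self[OF \<gamma>]
    by (intro the_equality) fastforce+
qed

lemma direction_angle_class: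
  fixes p :: "'a::cat0_space"
  assumes \<gamma>: "\<gamma> \<in> geodesics_from p" "\<gamma> 1 \<noteq> p" and \<delta>: "\<delta> \<in> geodesics_from p" "\<delta> 1 \<noteq> p"
  shows "direction_angle p (direction_rel p `` {\<gamma>}) (direction_rel p `` {\<delta>}) = alexandrov_angle p \<gamma> \<delta>"
proof -
  have "alexandrov_angle p \<gamma>' \<delta>' = alexandrov_angle p \<gamma> \<delta>"
    if "\<gamma>' \<in> direction_rel p `` {\<gamma>}" "\<delta>' \<in> direction_rel p `` {\<delta>}" for \<gamma>' \<delta>'
    using that alexandrov_angle_zero_geodesic[OF \<gamma>(1), of \<gamma>']
      alexandrov_angle_zero_geodesic[OF \<delta>(1), of \<delta>'] assms
    by (intro alexandrov_angle_cong) (auto simp: direction_rel_def)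
  then show ?thesis
    unfolding direction_angle_def using direction_rel_self[OF \<gamma>(1)] direction_rel_self[OF \<delta>(1)]
    by (intro the_equality) metis+
qed

text \<open>Equivalent pairs share the weight \<open>t * direction_zeta c\<close>, and also the
  direction if this weight is positive; if it is 0, the direction does not influence the product. So
  all representatives yield one value.\<close>

lemma tangent_inner_tangent_vector:
  fixes p :: "'a::cat0_space"
  assumes \<gamma>: "\<gamma> \<in> geodesics_from p" and \<delta>: "\<delta> \<in> geodesics_from p" and "t \<ge> 0" "u \<ge> 0"
  shows "tangent_inner p (tangent_vector p t \<gamma>) (tangent_vector p u \<delta>) =
    (if \<gamma> 1 = p \<or> \<delta> 1 = p then 0 else t * u * cos (alexandrov_angle p \<gamma> \<delta>))"
proof -
  let ?c = "direction_rel p `` {\<gamma>}" and ?d = "direction_rel p `` {\<delta>}"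
  define val where "val t\<^sub>1 c\<^sub>1 t\<^sub>2 c\<^sub>2 =
    t\<^sub>1 * t\<^sub>2 * direction_zeta c\<^sub>1 * direction_zeta c\<^sub>2 * cos (direction_angle p c\<^sub>1 c\<^sub>2)" for t\<^sub>1 c\<^sub>1 t\<^sub>2 c\<^sub>2
  have mem: "(t, direction_rel p `` {\<gamma>}) \<in> tangent_vector p t \<gamma>"
    if "\<gamma> \<in> geodesics_from p" "t \<ge> 0" for \<gamma> t
    using that direction_zeta_class[OF that(1)]
    by (auto simp: tangent_vector_def tangent_rel_def directions_def intro!: quotientI)
  have "val t\<^sub>1 c\<^sub>1 t\<^sub>2 c\<^sub>2 = val t ?c u ?d"
    if "(t\<^sub>1, c\<^sub>1) \<in> tangent_vector p t \<gamma>" "(t\<^sub>2, c\<^sub>2) \<in> tangent_vector p u \<delta>" for t\<^sub>1 c\<^sub>1 t\<^sub>2 c\<^sub>2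
    using that direction_zeta_class[OF \<gamma>] direction_zeta_class[OF \<delta>]
    by (auto simp: tangent_vector_def tangent_rel_def val_def)
  then have "tangent_inner p (tangent_vector p t \<gamma>) (tangent_vector p u \<delta>) = val t ?c u ?d"
    unfolding tangent_inner_def val_def[symmetric]
    using mem[OF \<gamma> \<open>t \<ge> 0\<close>] mem[OF \<delta> \<open>u \<ge> 0\<close>] by (intro the_equality) fast+
  then show ?thesis
    using assms by (auto simp: val_def direction_zeta_class direction_angle_class)
qed

lemma tangent_space_cases:
  assumes "v \<in> tangent_space p"
  obtains t \<gamma> where "t \<ge> 0" "\<gamma> \<in> geodesics_from p" "v = tangent_vector p t \<gamma>"
  using assms unfolding tangent_space_def directions_def tangent_vector_def quotient_def by blast

text \<open>The Alexandrov angle is at most the comparison angle, and the law of cosines rewrites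
  the latter in squared distances. If \<open>x\<close> or \<open>q\<close> equals \<open>p\<close>,
  both sides vanish.\<close>

lemma tangent_inner_geodesic_ge:
  fixes p x q :: "'a::cat0_space"
  assumes "t \<ge> 0"
  shows "t * ((dist p x)\<^sup>2 + (dist p q)\<^sup>2 - (dist x q)\<^sup>2)
    \<le> 2 * dist p q * tangent_inner p (tangent_vector p (t * dist p x) (geodesic p x))
        (tangent_vector p 1 (geodesic p q))"
proof (cases "x = p \<or> q = p")
  case True
  then show ?thesis
    using assms by (auto simp: tangent_inner_tangent_vector geodesic_props geodesic_in_geodesics_from dist_commute)
next
  case False
  have "comparison_cos p x q \<le> cos (alexandrov_angle p (geodesic p x) (geodesic p q))"
    using comparison_cos_le_cos_alexandrov_angle[of "geodesic p x" p "geodesic p q"] False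
    by (simp add: geodesic_props geodesic_in_geodesics_from)
  then have "t * (2 * dist p x * dist p q * comparison_cos p x q) \<le>
      t * (2 * dist p x * dist p q * cos (alexandrov_angle p (geodesic p x) (geodesic p q)))"
    using assms by (intro mult_left_mono) auto
  then show ?thesis
    using False assms unfolding comparison_cos_mult
    by (simp add: tangent_inner_tangent_vector geodesic_props geodesic_in_geodesics_from mult_ac)
qed

text \<open>A Cauchy-Schwarz bound: the second vector has norm at most 1, whatever the distance of
  \<open>p\<close> and \<open>q\<close>.\<close>

lemma tangent_inner_bound:
  fixes p q :: "'a::cat0_space"
  assumes "t \<ge> 0" "\<gamma> \<in> geodesics_from p"
  shows "\<bar>tangent_inner p (tangent_vector p t \<gamma>) (tangent_vector p 1 (geodesic p q))\<bar> \<le> t"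
  using assms by (auto simp: tangent_inner_tangent_vector geodesic_in_geodesics_from geodesic_props
      abs_mult mult_left_le)

section \<open>Resolvents\<close>

locale monotone_surjective_field =
  fixes A :: "'a::{cat0_space, complete_space} \<Rightarrow> 'a tangent set"
  assumes vector_field: "vector_field A"
    and monotone: "monotone_vf A"
    and surjective: "surjectivity_condition A"
begin

section \<open>The metric inequality for resolvents and its consequences\<close>

text \<open>Monotonicity for the two resolvent vectors reads \<open>I \<le> - J\<close>. Both inner
  products have lower bounds in squared distances, and multiplication by
  \<open>\<nu> * \<mu>\<close> clears the inverses.\<close>

lemma resolvent_set_ineq:
  assumes "\<nu> > 0" "\<mu> > 0" and z: "z \<in> resolvent_set A \<nu> x" and w: "w \<in> resolvent_set A \<mu> y"
  shows "(\<nu> + \<mu>) * (dist z w)\<^sup>2 + \<mu> * (dist z x)\<^sup>2 + \<nu> * (dist w y)\<^sup>2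
    \<le> \<mu> * (dist x w)\<^sup>2 + \<nu> * (dist y z)\<^sup>2"
proof -
  define I where "I = tangent_inner z (tangent_vector z (inverse \<nu> * dist z x) (geodesic z x))
    (tangent_vector z 1 (geodesic z w))"
  define J where "J = tangent_inner w (tangent_vector w (inverse \<mu> * dist w y) (geodesic w y))
    (tangent_vector w 1 (geodesic w z))"
  define P where "P = (dist z x)\<^sup>2 + (dist z w)\<^sup>2 - (dist x w)\<^sup>2"
  define Q where "Q = (dist w y)\<^sup>2 + (dist z w)\<^sup>2 - (dist y z)\<^sup>2"
  have "I \<le> - J"
    using monotone z w unfolding monotone_vf_def resolvent_set_def I_def J_def by blast
  then have "2 * dist z w * I + 2 * dist z w * J \<le> 0"
    using mult_left_mono[of "I + J" 0 "2 * dist z w"] by (simp add: algebra_simps)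
  moreover have "inverse \<nu> * P \<le> 2 * dist z w * I" "inverse \<mu> * Q \<le> 2 * dist z w * J"
    using tangent_inner_geodesic_ge[of "inverse \<nu>" z x w] tangent_inner_geodesic_ge[of "inverse \<mu>" w y z] assms
    by (auto simp: I_def J_def P_def Q_def dist_commute)
  ultimately have "inverse \<nu> * P + inverse \<mu> * Q \<le> 0" by linarith
  then have "\<nu> * \<mu> * (inverse \<nu> * P + inverse \<mu> * Q) \<le> 0"
    using assms by (simp add: mult_le_0_iff)
  also have "\<nu> * \<mu> * (inverse \<nu> * P + inverse \<mu> * Q) = \<mu> * P + \<nu> * Q"
    using assms by (simp add: field_simps)
  finally show ?thesis by (simp add: P_def Q_def algebra_simps)
qed

text \<open>Existence is the surjectivity condition for \<open>inverse \<nu>\<close>. For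
  uniqueness, equal parameters and equal base points make all terms of the metric inequality cancel
  except \<open>dist z w\<close>.\<close>

lemma resolvent_set_singleton:
  assumes "\<nu> > 0"
  shows "resolvent_set A \<nu> x = {resolvent A \<nu> x}"
proof -
  obtain z where "tangent_vector z (inverse \<nu> * dist z x) (geodesic z x) \<in> A z"
    using surjective assms unfolding surjectivity_condition_def
    by (meson positive_imp_inverse_positive)
  then have z: "z \<in> resolvent_set A \<nu> x" by (simp add: resolvent_set_def)
  have "w = z" if "w \<in> resolvent_set A \<nu> x" for w
  proof -
    have "(\<nu> + \<nu>) * (dist z w)\<^sup>2 \<le> 0"
      using resolvent_set_ineq[OF assms assms z that] by (simp add: dist_commute)
    then show ?thesis using assms by (simp add: mult_le_0_iff)
  qed
  with z have "resolvent_set A \<nu> x = {z}" by blast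
  then show ?thesis using assms by (simp add: resolvent_def)
qed

lemma resolvent_in_resolvent_set: "\<nu> > 0 \<Longrightarrow> resolvent A \<nu> x \<in> resolvent_set A \<nu> x"
  by (simp add: resolvent_set_singleton)

text \<open>For equal parameters the right-hand side of the metric inequality consists of the
  diagonals of the quadrilateral \<open>x, y, ?w, ?z\<close>. Bounding them by the sides leaves only
  two opposite sides to compare.\<close>

lemma resolvent_nonexpansive:
  assumes "\<nu> > 0"
  shows "dist (resolvent A \<nu> x) (resolvent A \<nu> y) \<le> dist x y"
proof -
  let ?z = "resolvent A \<nu> x" and ?w = "resolvent A \<nu> y"
  have "\<nu> * (2 * (dist ?z ?w)\<^sup>2 + (dist ?z x)\<^sup>2 + (dist ?w y)\<^sup>2) \<le> \<nu> * ((dist x ?w)\<^sup>2 + (dist y ?z)\<^sup>2)"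
    using resolvent_set_ineq[OF assms assms resolvent_in_resolvent_set resolvent_in_resolvent_set, of x y] assms
    by (simp add: algebra_simps)
  then have "2 * (dist ?z ?w)\<^sup>2 + (dist ?z x)\<^sup>2 + (dist ?w y)\<^sup>2 \<le> (dist x ?w)\<^sup>2 + (dist y ?z)\<^sup>2"
    using assms by simp
  with cat0_quadrilateral[of x ?w y ?z] have "(dist ?z ?w)\<^sup>2 \<le> (dist x y)\<^sup>2"
    unfolding dist_commute[of y ?w] dist_commute[of ?w ?z] by linarith
  then show ?thesis by (rule power2_le_imp_le) simp
qed

lemma resolvent_funpow_nonexpansive:
  "\<nu> > 0 \<Longrightarrow> dist ((resolvent A \<nu> ^^ n) x) ((resolvent A \<nu> ^^ n) y) \<le> dist x y"
  by (induction n) (auto intro: order_trans[OF resolvent_nonexpansive])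

text \<open>The inner product with the zero vector is 0, so monotonicity gives
  \<open>I \<le> 0\<close>: the angle at the resolvent point between \<open>x\<close> and
  \<open>p\<close> is not acute unless degenerate.\<close>

lemma resolvent_stationary:
  assumes "\<nu> > 0" and p: "p \<in> stationary_points A"
  shows "dist (resolvent A \<nu> x) p \<le> dist x p"
proof -
  let ?z = "resolvent A \<nu> x"
  define I where "I = tangent_inner ?z (tangent_vector ?z (inverse \<nu> * dist ?z x) (geodesic ?z x))
    (tangent_vector ?z 1 (geodesic ?z p))"
  have "I \<le> - tangent_inner p (zero_vector p) (tangent_vector p 1 (geodesic p ?z))"
    using monotone p resolvent_in_resolvent_set[OF assms(1), of x]
    unfolding monotone_vf_def resolvent_set_def stationary_points_def I_def by blast
  then have "I \<le> 0"
    by (simp add: zero_vector_def tangent_inner_tangent_vector geodesic_props geodesic_in_geodesics_from)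
  then have "2 * dist ?z p * I \<le> 0" by (simp add: mult_le_0_iff)
  with tangent_inner_geodesic_ge[of "inverse \<nu>" ?z x p]
  have "inverse \<nu> * ((dist ?z x)\<^sup>2 + (dist ?z p)\<^sup>2 - (dist x p)\<^sup>2) \<le> 0"
    using assms(1) by (simp add: I_def)
  then have "(dist ?z x)\<^sup>2 + (dist ?z p)\<^sup>2 \<le> (dist x p)\<^sup>2"
    using assms(1) by (simp add: mult_le_0_iff)
  then have "(dist ?z p)\<^sup>2 \<le> (dist x p)\<^sup>2"
    using zero_le_power2[of "dist ?z x"] by linarith
  then show ?thesis by (rule power2_le_imp_le) simp
qed

lemma resolvent_funpow_stationary:
  "\<nu> > 0 \<Longrightarrow> p \<in> stationary_points A \<Longrightarrow> dist ((resolvent A \<nu> ^^ n) x) p \<le> dist x p"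
  by (induction n) (auto intro: order_trans[OF resolvent_stationary])

text \<open>The constant \<open>u\<close> is the length of a fixed vector in \<open>A y\<close>,
  hence the same for all \<nu>. Monotonicity between \<open>y\<close> and its resolvent bounds
  \<open>I\<close> by \<open>u\<close>, while \<open>I\<close> dominates the displacement divided by
  \<nu>.\<close>

lemma resolvent_displacement:
  assumes "y \<in> vf_dom A"
  obtains u where "u \<ge> 0" "\<And>\<nu>. \<nu> > 0 \<Longrightarrow> dist (resolvent A \<nu> y) y \<le> \<nu> * u"
proof -
  obtain v where v: "v \<in> A y" using assms by (auto simp: vf_dom_def)
  then obtain u \<gamma> where u: "u \<ge> 0" "\<gamma> \<in> geodesics_from y" "v = tangent_vector y u \<gamma>"
    using vector_field unfolding vector_field_def by (meson subsetD tangent_space_cases)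
  have "dist (resolvent A \<nu> y) y \<le> \<nu> * u" if "\<nu> > 0" for \<nu>
  proof -
    let ?z = "resolvent A \<nu> y"
    define I where "I = tangent_inner ?z (tangent_vector ?z (inverse \<nu> * dist ?z y) (geodesic ?z y))
      (tangent_vector ?z 1 (geodesic ?z y))"
    have "I \<le> - tangent_inner y v (tangent_vector y 1 (geodesic y ?z))"
      using monotone v resolvent_in_resolvent_set[OF that, of y]
      unfolding monotone_vf_def resolvent_set_def I_def by blast
    also have "\<dots> \<le> u"
      using tangent_inner_bound[OF u(1,2), of ?z] by (simp add: u(3) abs_le_iff)
    finally have "2 * dist ?z y * I \<le> 2 * dist ?z y * u"
      by (intro mult_left_mono) auto
    with tangent_inner_geodesic_ge[of "inverse \<nu>" ?z y y]
    have "inverse \<nu> * (2 * (dist ?z y)\<^sup>2) \<le> 2 * dist ?z y * u"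
      using that by (simp add: I_def)
    then have "dist ?z y * dist ?z y \<le> dist ?z y * (\<nu> * u)"
      using that by (simp add: field_simps power2_eq_square)
    then show ?thesis
      using that u(1) by (cases "?z = y") auto
  qed
  with u(1) show thesis by (rule that)
qed

section \<open>Kobayashi's estimate and the exponential formula\<close>

lemma resolvent_funpow_displacement:
  assumes "\<nu> > 0"
  shows "dist ((resolvent A \<nu> ^^ n) y) y \<le> real n * dist (resolvent A \<nu> y) y"
proof (induction n)
  case (Suc n)
  have "dist ((resolvent A \<nu> ^^ Suc n) y) y
      \<le> dist (resolvent A \<nu> ((resolvent A \<nu> ^^ n) y)) (resolvent A \<nu> y) + dist (resolvent A \<nu> y) y"
    by (simp add: dist_triangle)
  also have "\<dots> \<le> dist ((resolvent A \<nu> ^^ n) y) y + dist (resolvent A \<nu> y) y"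
    using resolvent_nonexpansive[OF assms] by simp
  finally show ?case using Suc by (simp add: algebra_simps)
qed simp

text \<open>
  The weights \<open>\<mu> / (\<nu> + \<mu>)\<close> and \<open>\<nu> / (\<nu> + \<mu>)\<close> of the recursion satisfied by the left-hand side
  reproduce the right-hand side exactly.
\<close>

lemma Kobayashi_estimate:
  assumes \<nu>: "\<nu> > 0" and \<mu>: "\<mu> > 0"
    and u: "u \<ge> 0" "\<And>\<nu>. \<nu> > 0 \<Longrightarrow> dist (resolvent A \<nu> y) y \<le> \<nu> * u"
  shows "(dist ((resolvent A \<nu> ^^ m) y) ((resolvent A \<mu> ^^ n) y))\<^sup>2
    \<le> u\<^sup>2 * ((m * \<nu> - n * \<mu>)\<^sup>2 + m * \<nu>\<^sup>2 + n * \<mu>\<^sup>2)"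
proof -
  define a where "a m n = (dist ((resolvent A \<nu> ^^ m) y) ((resolvent A \<mu> ^^ n) y))\<^sup>2" for m n
  define F :: "nat \<Rightarrow> nat \<Rightarrow> real" where "F m n = (m * \<nu> - n * \<mu>)\<^sup>2 + m * \<nu>\<^sup>2 + n * \<mu>\<^sup>2" for m n
  \<comment> \<open>Boundary values of the double induction, where one index is 0. The extra term
    \<open>k * \<kappa>\<^sup>2\<close> is slack here.\<close>
  have start: "(dist ((resolvent A \<kappa> ^^ k) y) y)\<^sup>2 \<le> u\<^sup>2 * ((k * \<kappa>)\<^sup>2 + k * \<kappa>\<^sup>2)" if "\<kappa> > 0" for \<kappa> k
  proof -
    have "dist ((resolvent A \<kappa> ^^ k) y) y \<le> k * (\<kappa> * u)"
      using resolvent_funpow_displacement[OF that, of k y] u(2)[OF that]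
      by (meson mult_left_mono of_nat_0_le_iff order_trans)
    then have "(dist ((resolvent A \<kappa> ^^ k) y) y)\<^sup>2 \<le> (k * (\<kappa> * u))\<^sup>2"
      by (intro power_mono) auto
    also have "\<dots> \<le> u\<^sup>2 * ((k * \<kappa>)\<^sup>2 + k * \<kappa>\<^sup>2)"
      by (simp add: power_mult_distrib algebra_simps)
    finally show ?thesis .
  qed
  \<comment> \<open>The recursion for \<open>(Suc m, Suc n)\<close> refers to
    \<open>(m, Suc n)\<close> and \<open>(Suc m, n)\<close>, hence an induction on \<open>m\<close>
    for all \<open>n\<close> with an inner induction on \<open>n\<close>.\<close>
  have "a m n \<le> u\<^sup>2 * F m n"
  proof (induction m arbitrary: n)
    case 0
    show ?case using start[OF \<mu>, of n] by (simp add: a_def F_def dist_commute)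
  next
    case (Suc m)
    show ?case
    proof (induction n)
      case 0
      show ?case using start[OF \<nu>, of "Suc m"] by (simp add: a_def F_def)
    next
      case (Suc n)
      \<comment> \<open>The metric inequality for the last step of both iterations, with the squared
        displacements of these steps dropped.\<close>
      have "(\<nu> + \<mu>) * a (Suc m) (Suc n) \<le> \<mu> * a m (Suc n) + \<nu> * a (Suc m) n"
      proof -
        have "0 \<le> \<mu> * (dist (resolvent A \<nu> ((resolvent A \<nu> ^^ m) y)) ((resolvent A \<nu> ^^ m) y))\<^sup>2"
          "0 \<le> \<nu> * (dist (resolvent A \<mu> ((resolvent A \<mu> ^^ n) y)) ((resolvent A \<mu> ^^ n) y))\<^sup>2"
          using \<nu> \<mu> by auto
        with resolvent_set_ineq[OF \<nu> \<mu> resolvent_in_resolvent_set[OF \<nu>] resolvent_in_resolvent_set[OF \<mu>],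
            of "(resolvent A \<nu> ^^ m) y" "(resolvent A \<mu> ^^ n) y"]
        show ?thesis
          unfolding a_def funpow.simps o_apply by (simp only: dist_commute[of "(resolvent A \<mu> ^^ n) y"])
      qed
      also have "\<dots> \<le> \<mu> * (u\<^sup>2 * F m (Suc n)) + \<nu> * (u\<^sup>2 * F (Suc m) n)"
        using \<open>\<And>n. a m n \<le> u\<^sup>2 * F m n\<close> Suc.IH \<nu> \<mu> by (intro add_mono mult_left_mono) auto
      also have "\<dots> = (\<nu> + \<mu>) * (u\<^sup>2 * F (Suc m) (Suc n))"
        unfolding F_def of_nat_Suc by algebra
      finally show ?case using \<nu> \<mu> by simp
    qed
  qed
  then show ?thesis by (simp add: a_def F_def)
qed

text \<open>The estimate requires a point of bounded displacement, so \<open>x\<close> is replaced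
  by a nearby \<open>y\<close> in the domain; nonexpansiveness keeps the error below
  \<open>\<epsilon> / 3\<close> along both iterations.\<close>

lemma resolvent_funpow_close:
  assumes x: "x \<in> closure (vf_dom A)" and "\<epsilon> > 0"
  obtains \<delta> where "\<delta> > 0"
    "\<And>\<nu> \<mu> m n. \<lbrakk>0 < \<nu>; \<nu> < \<delta>; 0 < \<mu>; \<mu> < \<delta>; \<bar>real m * \<nu> - s\<bar> < \<delta>; \<bar>real n * \<mu> - s\<bar> < \<delta>\<rbrakk> \<Longrightarrow>
      dist ((resolvent A \<nu> ^^ m) x) ((resolvent A \<mu> ^^ n) x) < \<epsilon>"
proof -
  obtain y where y: "y \<in> vf_dom A" "dist y x < \<epsilon> / 3"
    using x \<open>\<epsilon> > 0\<close> unfolding closure_approachable by (meson divide_pos_pos zero_less_numeral)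
  obtain u where u: "u \<ge> 0" "\<And>\<nu>. \<nu> > 0 \<Longrightarrow> dist (resolvent A \<nu> y) y \<le> \<nu> * u"
    using resolvent_displacement[OF y(1)] by blast
  \<comment> \<open>Dominates Kobayashi's bound: the elapsed times differ by at most
    \<open>2 * \<delta>\<close>, and \<open>m * \<nu>\<^sup>2\<close> is an elapsed time of at most
    \<open>\<bar>s\<bar> + \<delta>\<close> multiplied by a step size below \<delta>.\<close>
  define G where "G \<delta> = u\<^sup>2 * ((2 * \<delta>)\<^sup>2 + (\<bar>s\<bar> + \<delta>) * \<delta> + (\<bar>s\<bar> + \<delta>) * \<delta>)" for \<delta>
  have "(G \<longlongrightarrow> u\<^sup>2 * ((2 * 0)\<^sup>2 + (\<bar>s\<bar> + 0) * 0 + (\<bar>s\<bar> + 0) * 0)) (at_right 0)"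
    unfolding G_def by (intro tendsto_intros)
  then have "eventually (\<lambda>\<delta>. G \<delta> < (\<epsilon> / 3)\<^sup>2) (at_right 0)"
    using \<open>\<epsilon> > 0\<close> by (intro order_tendstoD(2)[where y = 0]) auto
  moreover have "eventually (\<lambda>\<delta>::real. \<delta> > 0) (at_right 0)"
    by (simp add: eventually_at_right_less)
  ultimately obtain \<delta> where \<delta>: "\<delta> > 0" "G \<delta> < (\<epsilon> / 3)\<^sup>2"
    using eventually_happens'[OF trivial_limit_at_right_real eventually_conj] by blast
  have "dist ((resolvent A \<nu> ^^ m) x) ((resolvent A \<mu> ^^ n) x) < \<epsilon>"
    if h: "0 < \<nu>" "\<nu> < \<delta>" "0 < \<mu>" "\<mu> < \<delta>" "\<bar>real m * \<nu> - s\<bar> < \<delta>" "\<bar>real n * \<mu> - s\<bar> < \<delta>" for \<nu> \<mu> m n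
  proof -
    let ?a = "(resolvent A \<nu> ^^ m) y" and ?b = "(resolvent A \<mu> ^^ n) y"
    have "\<bar>m * \<nu> - n * \<mu>\<bar> \<le> \<bar>2 * \<delta>\<bar>" using h by linarith
    then have 1: "(m * \<nu> - n * \<mu>)\<^sup>2 \<le> (2 * \<delta>)\<^sup>2" by (simp only: abs_le_square_iff)
    have 2: "m * \<nu>\<^sup>2 \<le> (\<bar>s\<bar> + \<delta>) * \<delta>" "n * \<mu>\<^sup>2 \<le> (\<bar>s\<bar> + \<delta>) * \<delta>"
      using h mult_mono[of "m * \<nu>" "\<bar>s\<bar> + \<delta>" \<nu> \<delta>] mult_mono[of "n * \<mu>" "\<bar>s\<bar> + \<delta>" \<mu> \<delta>]
      by (auto simp: power2_eq_square mult.assoc)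
    have "(dist ?a ?b)\<^sup>2 \<le> u\<^sup>2 * ((m * \<nu> - n * \<mu>)\<^sup>2 + m * \<nu>\<^sup>2 + n * \<mu>\<^sup>2)"
      using h u by (intro Kobayashi_estimate)
    also have "\<dots> \<le> G \<delta>"
      unfolding G_def using 1 2 by (intro mult_left_mono add_mono) auto
    finally have "(dist ?a ?b)\<^sup>2 < (\<epsilon> / 3)\<^sup>2" using \<delta>(2) by linarith
    then have "dist ?a ?b < \<epsilon> / 3"
      by (rule power2_less_imp_less) (use \<open>\<epsilon> > 0\<close> in simp)
    moreover have "dist ((resolvent A \<nu> ^^ m) x) ?a < \<epsilon> / 3" "dist ?b ((resolvent A \<mu> ^^ n) x) < \<epsilon> / 3"
      using resolvent_funpow_nonexpansive[of \<nu> m x y] resolvent_funpow_nonexpansive[of \<mu> n y x] h y(2)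
      by (simp_all add: dist_commute)
    ultimately show ?thesis by metric
  qed
  with \<delta>(1) show thesis by (rule that)
qed

lemma semigroup_approx_0: "semigroup_approx A 0 x k = x"
proof -
  have "resolvent A 0 = id" by (auto simp: resolvent_def)
  then show ?thesis by (simp add: semigroup_approx_def)
qed

lemma semigroup_approx_convergent:
  assumes x: "x \<in> closure (vf_dom A)" and "t \<ge> 0"
  shows "convergent (semigroup_approx A t x)"
proof (cases "t = 0")
  case True
  then show ?thesis by (simp add: semigroup_approx_0[abs_def] convergent_const)
next
  case False
  then have t: "t > 0" using assms by simp
  have "Cauchy (semigroup_approx A t x)"
  proof (rule metric_CauchyI)
    fix \<epsilon> :: real assume "\<epsilon> > 0"
    obtain \<delta> where \<delta>: "\<delta> > 0"
      "\<And>\<nu> \<mu> m n. \<lbrakk>0 < \<nu>; \<nu> < \<delta>; 0 < \<mu>; \<mu> < \<delta>; \<bar>real m * \<nu> - t\<bar> < \<delta>; \<bar>real n * \<mu> - t\<bar> < \<delta>\<rbrakk> \<Longrightarrow>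
        dist ((resolvent A \<nu> ^^ m) x) ((resolvent A \<mu> ^^ n) x) < \<epsilon>"
      using resolvent_funpow_close[OF x \<open>\<epsilon> > 0\<close>] by blast
    \<comment> \<open>Beyond \<open>N\<close> the step size is below \<delta>. This also excludes
      \<open>k = 0\<close>, for which \<open>k * (t / k)\<close> is 0 and not
      \<open>t\<close>.\<close>
    obtain N where N: "t / \<delta> < real N" using reals_Archimedean2 by blast
    have *: "0 < t / k \<and> t / k < \<delta> \<and> \<bar>k * (t / k) - t\<bar> < \<delta>" if "k \<ge> N" for k
    proof -
      have "t / \<delta> < k" using N that by linarith
      moreover have "0 < t / \<delta>" using t \<delta>(1) by simp
      ultimately have "0 < real k" by linarith
      then show ?thesis using \<open>t / \<delta> < k\<close> t \<delta>(1) by (simp add: field_simps)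
    qed
    show "\<exists>M. \<forall>m\<ge>M. \<forall>n\<ge>M. dist (semigroup_approx A t x m) (semigroup_approx A t x n) < \<epsilon>"
      unfolding semigroup_approx_def using * \<delta>(2) by blast
  qed
  then show ?thesis by (rule Cauchy_convergent)
qed

lemma semigroup_approx_tendsto:
  "x \<in> closure (vf_dom A) \<Longrightarrow> t \<ge> 0 \<Longrightarrow> semigroup_approx A t x \<longlonglongrightarrow> generated_semigroup A t x"
  unfolding generated_semigroup_def using semigroup_approx_convergent convergent_LIMSEQ_iff by blast

text \<open>Extends the exponential formula to arbitrary step sizes tending to 0, by comparison with
  the steps \<open>s / k\<close>. It allows the semigroup at two different times to be approximated
  with a common step size.\<close>

lemma resolvent_funpow_tendsto:
  fixes l :: "nat \<Rightarrow> real" and m :: "nat \<Rightarrow> nat"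
  assumes x: "x \<in> closure (vf_dom A)" and s: "s > 0"
    and l: "eventually (\<lambda>k. l k > 0) sequentially" "l \<longlonglongrightarrow> 0" and m: "(\<lambda>k. real (m k) * l k) \<longlonglongrightarrow> s"
  shows "(\<lambda>k. (resolvent A (l k) ^^ m k) x) \<longlonglongrightarrow> generated_semigroup A s x"
proof -
  have "(\<lambda>k. dist ((resolvent A (l k) ^^ m k) x) (semigroup_approx A s x k)) \<longlonglongrightarrow> 0"
  proof (rule tendstoI)
    fix \<epsilon> :: real assume "\<epsilon> > 0"
    obtain \<delta> where \<delta>: "\<delta> > 0"
      "\<And>\<nu> \<mu> m n. \<lbrakk>0 < \<nu>; \<nu> < \<delta>; 0 < \<mu>; \<mu> < \<delta>; \<bar>real m * \<nu> - s\<bar> < \<delta>; \<bar>real n * \<mu> - s\<bar> < \<delta>\<rbrakk> \<Longrightarrow>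
        dist ((resolvent A \<nu> ^^ m) x) ((resolvent A \<mu> ^^ n) x) < \<epsilon>"
      using resolvent_funpow_close[OF x \<open>\<epsilon> > 0\<close>] by blast
    have "eventually (\<lambda>k. dist (s / real k) 0 < \<delta>) sequentially"
      using \<delta>(1) by (intro tendstoD lim_const_over_n)
    moreover have "eventually (\<lambda>k. dist (l k) 0 < \<delta>) sequentially"
      "eventually (\<lambda>k. dist (m k * l k) s < \<delta>) sequentially"
      by (rule tendstoD[OF l(2) \<delta>(1)], rule tendstoD[OF m \<delta>(1)])
    ultimately show "eventually (\<lambda>k. dist (dist ((resolvent A (l k) ^^ m k) x) (semigroup_approx A s x k)) 0 < \<epsilon>) sequentially"
      using l(1) eventually_gt_at_top[of 0]
    proof eventually_elim
      case (elim k)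
      then show ?case
        using s \<delta> by (simp add: semigroup_approx_def dist_real_def)
    qed
  qed
  moreover have "(\<lambda>k. dist (semigroup_approx A s x k) (generated_semigroup A s x)) \<longlonglongrightarrow> 0"
    using semigroup_approx_tendsto[OF x] s by (simp flip: tendsto_dist_iff)
  ultimately have "(\<lambda>k. dist ((resolvent A (l k) ^^ m k) x) (semigroup_approx A s x k)
      + dist (semigroup_approx A s x k) (generated_semigroup A s x)) \<longlonglongrightarrow> 0"
    by (rule tendsto_add_zero)
  then show ?thesis
    unfolding tendsto_dist_iff[of _ "generated_semigroup A s x"]
    by (rule Lim_null_comparison[rotated]) (simp add: dist_triangle)
qed

section \<open>Fejer monotonicity of the semigroup\<close>

text \<open>With the common step \<open>t / k\<close>, the approximant at time \<open>t\<close>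
  arises from one at time \<open>s\<close> by further resolvent steps, none of which moves away from
  \<open>p\<close>. This takes the place of the semigroup law.\<close>

lemma generated_semigroup_Fejer:
  assumes x: "x \<in> closure (vf_dom A)" and p: "p \<in> stationary_points A" and st: "0 \<le> s" "s \<le> t"
  shows "dist (generated_semigroup A t x) p \<le> dist (generated_semigroup A s x) p"
proof (cases "s = t")
  case False
  then have t: "t > 0" using st by simp
  have lim: "(\<lambda>k. dist (semigroup_approx A t x k) p) \<longlonglongrightarrow> dist (generated_semigroup A t x) p"
    using x t by (intro tendsto_intros semigroup_approx_tendsto) auto
  show ?thesis
  proof (cases "s = 0")
    case True
    have "generated_semigroup A 0 x = x"
      by (simp add: generated_semigroup_def semigroup_approx_0[abs_def])
    moreover have "dist (generated_semigroup A t x) p \<le> dist x p"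
      using t p unfolding semigroup_approx_def
      by (intro tendsto_upperbound[OF lim] eventually_mono[OF eventually_gt_at_top[of 0]])
        (auto simp: semigroup_approx_def resolvent_funpow_stationary)
    ultimately show ?thesis using True by simp
  next
    case False
    then have s: "s > 0" using st by simp
    \<comment> \<open>The largest number of steps of size \<open>t / k\<close> that does not pass
      time \<open>s\<close>, for positive \<open>k\<close>; the elapsed time misses \<open>s\<close>
      by at most \<open>t / k\<close>.\<close>
    define m where "m k = nat \<lfloor>s * k / t\<rfloor>" for k :: nat
    have m: "m k \<le> s * k / t" "s * k / t - 1 \<le> m k" for k
      using s t by (auto simp: m_def)
    have m_le: "m k \<le> k" for k
    proof -
      have "s * k / t \<le> k" using st t by (simp add: field_simps mult_right_mono)
      with m(1)[of k] show ?thesis by linarith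
    qed
    have "(\<lambda>k. m k * (t / k)) \<longlonglongrightarrow> s"
    proof (rule tendsto_sandwich)
      show "(\<lambda>k. s - t / real k) \<longlonglongrightarrow> s"
        using tendsto_diff[OF tendsto_const lim_const_over_n[of t]] by simp
      show "(\<lambda>k. s) \<longlonglongrightarrow> s" by simp
      have "s - t / real k \<le> m k * (t / k) \<and> m k * (t / k) \<le> s" if "k > 0" for k
        using mult_right_mono[OF m(1)[of k], of "t / k"] mult_right_mono[OF m(2)[of k], of "t / k"] t that
        by (simp add: left_diff_distrib diff_divide_distrib)
      then show "eventually (\<lambda>k. s - t / real k \<le> m k * (t / k)) sequentially"
        "eventually (\<lambda>k. m k * (t / k) \<le> s) sequentially"
        by (auto intro: eventually_mono[OF eventually_gt_at_top[of 0]])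
    qed
    then have "(\<lambda>k. (resolvent A (t / k) ^^ m k) x) \<longlonglongrightarrow> generated_semigroup A s x"
      using t by (intro resolvent_funpow_tendsto x s lim_const_over_n eventually_mono[OF eventually_gt_at_top[of 0]]) auto
    then have lim': "(\<lambda>k. dist ((resolvent A (t / k) ^^ m k) x) p) \<longlonglongrightarrow> dist (generated_semigroup A s x) p"
      by (intro tendsto_intros)
    have "dist (semigroup_approx A t x k) p \<le> dist ((resolvent A (t / k) ^^ m k) x) p" if "k > 0" for k
    proof -
      have "semigroup_approx A t x k = (resolvent A (t / k) ^^ (k - m k)) ((resolvent A (t / k) ^^ m k) x)"
        using m_le[of k] by (simp add: semigroup_approx_def flip: funpow_add comp_apply[of "_ ^^ _" "_ ^^ _"])
      then show ?thesis using that t p by (simp add: resolvent_funpow_stationary)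
    qed
    then show ?thesis
      by (intro tendsto_le[OF _ lim' lim] eventually_mono[OF eventually_gt_at_top[of 0]]) auto
  qed
qed simp

end

section \<open>Asymptotic centers\<close>

lemma asymptotic_radius_at_less:
  "asymptotic_radius_at X y < ereal c \<Longrightarrow> eventually (\<lambda>k. dist y (X k) < c) sequentially"
  unfolding asymptotic_radius_at_def by (drule Limsup_lessD) simp

lemma asymptotic_radius_at_le:
  "eventually (\<lambda>k. dist y (X k) \<le> c) sequentially \<Longrightarrow> asymptotic_radius_at X y \<le> ereal c"
  unfolding asymptotic_radius_at_def by (intro Limsup_bounded) simp

lemma asymptotic_radius_at_nonneg: "0 \<le> asymptotic_radius_at X y"
  unfolding asymptotic_radius_at_def by (intro le_Limsup) (auto simp: zero_ereal_def)

lemma asymptotic_radius_at_subseq: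
  "strict_mono r \<Longrightarrow> asymptotic_radius_at (X \<circ> r) y \<le> asymptotic_radius_at X y"
  using limsup_subseq_mono[of r "\<lambda>k. ereal (dist y (X k))"] by (simp add: asymptotic_radius_at_def comp_def)

text \<open>Separating the infimum from its minimizers allows subsequences to be compared before
  asymptotic centers are known to exist.\<close>

definition asymptotic_radius :: "(nat \<Rightarrow> 'a::metric_space) \<Rightarrow> ereal" where
  "asymptotic_radius X = (INF y. asymptotic_radius_at X y)"

lemma asymptotic_radius_le: "asymptotic_radius X \<le> asymptotic_radius_at X y"
  unfolding asymptotic_radius_def by (rule INF_lower) simp

lemma asymptotic_radius_nonneg: "0 \<le> asymptotic_radius X"
  unfolding asymptotic_radius_def by (intro INF_greatest asymptotic_radius_at_nonneg)

lemma asymptotic_radius_subseq: "strict_mono r \<Longrightarrow> asymptotic_radius (X \<circ> r) \<le> asymptotic_radius X"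
  unfolding asymptotic_radius_def by (intro INF_mono) (auto intro: asymptotic_radius_at_subseq)

lemma asymptotic_radius_shift: "asymptotic_radius (X \<circ> (+) k) = asymptotic_radius X"
  unfolding asymptotic_radius_def asymptotic_radius_at_def comp_def
  using limsup_shift_k[of "\<lambda>j. ereal (dist _ (X j))" k] by (simp add: add.commute)

lemma asymptotic_radius_finite:
  assumes "bounded (range X)"
  obtains R where "asymptotic_radius X = ereal R" "R \<ge> 0"
proof -
  \<comment> \<open>\<open>undefined\<close> serves as an arbitrary base point of the space.\<close>
  obtain e where "\<And>k. dist undefined (X k) \<le> e"
    using assms unfolding bounded_any_center[where a = undefined] by auto
  then have "asymptotic_radius_at X undefined \<le> ereal e"
    by (intro asymptotic_radius_at_le) simp
  with asymptotic_radius_le have "asymptotic_radius X \<le> ereal e"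
    by (rule order_trans)
  with asymptotic_radius_nonneg[of X] that show thesis
    by (cases "asymptotic_radius X") auto
qed

text \<open>By the CN inequality the midpoint of \<open>y\<close> and \<open>z\<close> has squared
  radius at most \<open>c\<^sup>2 - (dist y z)\<^sup>2 / 4\<close>, which cannot be smaller than
  \<open>R\<^sup>2\<close>. Uniqueness and existence of centers both rest on this.\<close>

lemma almost_centers_close:
  fixes X :: "nat \<Rightarrow> 'a::cat0_space"
  assumes R: "asymptotic_radius X = ereal R" "R \<ge> 0"
    and yz: "asymptotic_radius_at X y < ereal c" "asymptotic_radius_at X z < ereal c"
  shows "(dist y z)\<^sup>2 \<le> 4 * (c\<^sup>2 - R\<^sup>2)"
proof -
  obtain m where m: "\<And>x. (dist m x)\<^sup>2 \<le> ((dist y x)\<^sup>2 + (dist z x)\<^sup>2) / 2 - (dist y z)\<^sup>2 / 4"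
    using Bruhat_Tits_midpoint[of y z] by blast
  define e where "e = c\<^sup>2 - (dist y z)\<^sup>2 / 4"
  have ev: "eventually (\<lambda>k. (dist m (X k))\<^sup>2 \<le> e) sequentially"
    using asymptotic_radius_at_less[OF yz(1)] asymptotic_radius_at_less[OF yz(2)]
  proof eventually_elim
    case (elim k)
    then have "(dist y (X k))\<^sup>2 \<le> c\<^sup>2" "(dist z (X k))\<^sup>2 \<le> c\<^sup>2"
      by (auto intro!: power_mono)
    with m[of "X k"] show ?case by (simp add: e_def field_simps)
  qed
  \<comment> \<open>One actual squared distance below \<open>e\<close> shows that \<open>e\<close>
    is nonnegative, so that squaring \<open>sqrt e\<close> returns \<open>e\<close>.\<close>
  then obtain k where "(dist m (X k))\<^sup>2 \<le> e"
    using eventually_happens'[OF sequentially_bot] by blast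
  then have "e \<ge> 0"
    using zero_le_power2[of "dist m (X k)"] by linarith
  have "ereal R \<le> asymptotic_radius_at X m"
    using asymptotic_radius_le[of X m] R by simp
  also have "\<dots> \<le> ereal (sqrt e)"
    using ev by (intro asymptotic_radius_at_le) (auto elim!: eventually_mono intro: real_le_rsqrt)
  finally have "R\<^sup>2 \<le> (sqrt e)\<^sup>2" using R(2) by (intro power_mono) auto
  then show ?thesis using \<open>e \<ge> 0\<close> by (simp add: e_def)
qed

text \<open>Uniqueness comes for free: two minimizers have radius below every \<open>c > R\<close>,
  and letting \<open>c\<close> tend to \<open>R\<close> forces their distance to be 0.\<close>

lemma is_asymptotic_center_iff:
  fixes X :: "nat \<Rightarrow> 'a::cat0_space"
  assumes "bounded (range X)"
  shows "is_asymptotic_center X z \<longleftrightarrow> asymptotic_radius_at X z = asymptotic_radius X"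
proof -
  obtain R where R: "asymptotic_radius X = ereal R" "R \<ge> 0"
    using asymptotic_radius_finite[OF assms] .
  have argmin: "is_arg_min (asymptotic_radius_at X) (\<lambda>_. True) y \<longleftrightarrow> asymptotic_radius_at X y = asymptotic_radius X" for y
    unfolding is_arg_min_linorder asymptotic_radius_def
    by (auto intro!: antisym INF_greatest INF_lower)
  have "y = z" if y: "asymptotic_radius_at X y = ereal R" and z: "asymptotic_radius_at X z = ereal R" for y z
  proof -
    have "((\<lambda>c. 4 * (c\<^sup>2 - R\<^sup>2)) \<longlongrightarrow> 4 * (R\<^sup>2 - R\<^sup>2)) (at_right R)"
      by (intro tendsto_intros)
    moreover have "eventually (\<lambda>c. (dist y z)\<^sup>2 \<le> 4 * (c\<^sup>2 - R\<^sup>2)) (at_right R)"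
      using almost_centers_close[OF R, of y _ z] y z by (intro eventually_at_rightI[of R "R + 1"]) auto
    ultimately have "(dist y z)\<^sup>2 \<le> 4 * (R\<^sup>2 - R\<^sup>2)"
      by (intro tendsto_lowerbound) auto
    then show ?thesis by simp
  qed
  then show ?thesis unfolding is_asymptotic_center_def argmin R(1) by blast
qed

text \<open>A minimizing sequence is Cauchy because almost centers are close to each other, and the
  radius at its limit exceeds that of its terms by at most their distance to the limit.\<close>

lemma asymptotic_center_exists:
  fixes X :: "nat \<Rightarrow> 'a::{cat0_space, complete_space}"
  assumes "bounded (range X)"
  shows "\<exists>z. asymptotic_radius_at X z = asymptotic_radius X"
proof -
  obtain R where R: "asymptotic_radius X = ereal R" "R \<ge> 0"
    using asymptotic_radius_finite[OF assms] .
  have "\<exists>y. asymptotic_radius_at X y < ereal (R + inverse (real (Suc n)))" for n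
  proof -
    have "(INF y. asymptotic_radius_at X y) < ereal (R + inverse (real (Suc n)))"
      using R(1) by (simp add: asymptotic_radius_def)
    then show ?thesis by (simp add: INF_less_iff)
  qed
  then obtain y where y: "\<And>n. asymptotic_radius_at X (y n) < ereal (R + inverse (real (Suc n)))"
    by metis
  define g where "g n = 4 * ((R + inverse (real (Suc n)))\<^sup>2 - R\<^sup>2)" for n
  have dist_le: "(dist (y i) (y j))\<^sup>2 \<le> g n" if "i \<ge> n" "j \<ge> n" for i j n
  proof -
    have "asymptotic_radius_at X (y k) < ereal (R + inverse (real (Suc n)))" if "k \<ge> n" for k
    proof -
      have "inverse (real (Suc k)) \<le> inverse (real (Suc n))"
        using that by (intro le_imp_inverse_le) auto
      then show ?thesis by (intro less_le_trans[OF y[of k]]) simp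
    qed
    with that show ?thesis unfolding g_def by (intro almost_centers_close[OF R]) auto
  qed
  have "g \<longlonglongrightarrow> 4 * ((R + 0)\<^sup>2 - R\<^sup>2)"
    unfolding g_def by (intro tendsto_intros LIMSEQ_inverse_real_of_nat)
  then have g0: "g \<longlonglongrightarrow> 0" by simp
  have "Cauchy y"
  proof (rule metric_CauchyI)
    fix e :: real assume "e > 0"
    then have "eventually (\<lambda>n. g n < e\<^sup>2) sequentially"
      using g0 by (intro order_tendstoD(2)[where y = 0]) auto
    then obtain n where n: "g n < e\<^sup>2" by (auto simp: eventually_sequentially)
    have "dist (y i) (y j) < e" if "i \<ge> n" "j \<ge> n" for i j
      by (rule power2_less_imp_less[OF le_less_trans[OF dist_le[OF that] n]]) (use \<open>e > 0\<close> in simp)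
    then show "\<exists>n. \<forall>i\<ge>n. \<forall>j\<ge>n. dist (y i) (y j) < e" by blast
  qed
  then obtain z where z: "y \<longlonglongrightarrow> z" by (auto simp: Cauchy_convergent_iff convergent_def)
  have "asymptotic_radius_at X z \<le> asymptotic_radius X + ereal c" if "c > 0" for c
  proof -
    have "eventually (\<lambda>n. dist (y n) z < c / 2) sequentially"
      "eventually (\<lambda>n. inverse (real (Suc n)) < c / 2) sequentially"
      by (rule tendstoD[OF z], use that in simp)
        (rule order_tendstoD(2)[OF LIMSEQ_inverse_real_of_nat], use that in simp)
    then have "eventually (\<lambda>n. dist (y n) z < c / 2 \<and> inverse (real (Suc n)) < c / 2) sequentially"
      by (rule eventually_conj)
    then obtain n where n: "dist (y n) z < c / 2" "inverse (real (Suc n)) < c / 2"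
      using eventually_happens'[OF sequentially_bot] by blast
    have "eventually (\<lambda>k. dist z (X k) \<le> R + c) sequentially"
      using asymptotic_radius_at_less[OF y[of n]]
    proof eventually_elim
      case (elim k)
      have "dist z (X k) \<le> dist (y n) z + dist (y n) (X k)" by (rule dist_triangle3)
      with elim n show ?case by linarith
    qed
    then show ?thesis using asymptotic_radius_at_le[of z X "R + c"] R(1) by simp
  qed
  then have "asymptotic_radius_at X z \<le> asymptotic_radius X"
    by (rule ereal_le_epsilon2)
  then show ?thesis using asymptotic_radius_le[of X z] by (intro exI[of _ z] antisym)
qed

section \<open>Delta-convergent subsequences\<close>

lemma bounded_subseq: "bounded (range X) \<Longrightarrow> bounded (range (X \<circ> r))"
  by (erule bounded_subset) auto

text \<open>
  Along a subsequence whose asymptotic radius does not decrease when passing to further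
  subsequences, the asymptotic center is inherited by all further subsequences.
\<close>

lemma regular_subsequence:
  fixes X :: "nat \<Rightarrow> 'a::metric_space"
  assumes "bounded (range X)"
  obtains d :: "nat \<Rightarrow> nat" where "strict_mono d"
    "\<And>r::nat \<Rightarrow> nat. strict_mono r \<Longrightarrow> asymptotic_radius (X \<circ> d \<circ> r) = asymptotic_radius (X \<circ> d)"
proof -
  \<comment> \<open>Regularity up to the error \<open>1 / (n + 1)\<close>. It survives passing to
    subsequences, so a diagonal sequence has it for every \<open>n\<close>, up to finitely many
    initial terms.\<close>
  define P where "P n s \<longleftrightarrow> (\<forall>r. strict_mono r \<longrightarrow>
    asymptotic_radius (X \<circ> s) \<le> asymptotic_radius (X \<circ> s \<circ> r) + ereal (inverse (real (Suc n))))"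
    for n and s :: "nat \<Rightarrow> nat"
  interpret subseqs P
  proof
    fix n and s :: "nat \<Rightarrow> nat" assume "strict_mono s"
    \<comment> \<open>A subsequence whose radius is within the error of \<open>I\<close> suffices,
      as its own subsequences cannot fall below \<open>I\<close>. Finiteness of \<open>I\<close>
      makes the added error a strict increase.\<close>
    define I where "I = (INF r\<in>{r. strict_mono r}. asymptotic_radius (X \<circ> s \<circ> r))"
    have "0 \<le> I" unfolding I_def by (intro INF_greatest asymptotic_radius_nonneg)
    moreover obtain R where "asymptotic_radius (X \<circ> s \<circ> id) = ereal R"
      using asymptotic_radius_finite[OF bounded_subseq[OF bounded_subseq[OF assms]]] by blast
    then have "I \<le> ereal R"
      unfolding I_def by (intro INF_lower2[of id]) (auto simp: strict_mono_def)
    ultimately have "I < I + ereal (inverse (real (Suc n)))"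
      by (cases I) auto
    then obtain r where r: "strict_mono r"
      "asymptotic_radius (X \<circ> s \<circ> r) < I + ereal (inverse (real (Suc n)))"
      by (auto simp: I_def INF_less_iff)
    have "I \<le> asymptotic_radius (X \<circ> s \<circ> (r \<circ> r'))" if "strict_mono r'" for r'
      unfolding I_def using r(1) that by (intro INF_lower) (simp add: strict_mono_o)
    then have "P n (s \<circ> r)"
      unfolding P_def using r(2)
      by (auto simp: comp_assoc intro: order_trans[OF less_imp_le add_right_mono])
    then show "\<exists>r'. strict_mono r' \<and> P n (s \<circ> r')" using r(1) by blast
  qed
  have P_diag: "P n (diagseq \<circ> (+) (Suc n))" for n
  proof (rule diagseq_holds)
    fix n and s r :: "nat \<Rightarrow> nat" assume r: "strict_mono r" and "P n s"
    show "P n (s \<circ> r)"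
      unfolding P_def
    proof (intro allI impI)
      fix r' :: "nat \<Rightarrow> nat" assume "strict_mono r'"
      have "asymptotic_radius (X \<circ> (s \<circ> r)) \<le> asymptotic_radius (X \<circ> s)"
        using asymptotic_radius_subseq[OF r, of "X \<circ> s"] by (simp add: comp_assoc)
      also have "\<dots> \<le> asymptotic_radius (X \<circ> s \<circ> (r \<circ> r')) + ereal (inverse (real (Suc n)))"
        using \<open>P n s\<close> strict_mono_o[OF r \<open>strict_mono r'\<close>] unfolding P_def by blast
      finally show "asymptotic_radius (X \<circ> (s \<circ> r))
          \<le> asymptotic_radius (X \<circ> (s \<circ> r) \<circ> r') + ereal (inverse (real (Suc n)))"
        by (simp add: comp_assoc)
    qed
  qed
  have "asymptotic_radius (X \<circ> diagseq \<circ> r) = asymptotic_radius (X \<circ> diagseq)" if r: "strict_mono r" for r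
  proof (rule antisym)
    show "asymptotic_radius (X \<circ> diagseq \<circ> r) \<le> asymptotic_radius (X \<circ> diagseq)"
      using r by (rule asymptotic_radius_subseq)
    have step: "asymptotic_radius (X \<circ> diagseq) \<le> asymptotic_radius (X \<circ> diagseq \<circ> r) + ereal (inverse (real (Suc n)))" for n
    proof -
      \<comment> \<open>The tail of \<open>r\<close>, re-indexed to run through the shifted diagonal
        sequence. The subtraction does not truncate, because a strictly increasing \<open>r\<close>
        satisfies \<open>j \<le> r j\<close>.\<close>
      define r' where "r' k = r (Suc n + k) - Suc n" for k
      have ge: "Suc n + k \<le> r (Suc n + k)" for k
        using r by (rule strict_mono_imp_increasing)
      have "strict_mono r'"
      proof (rule strict_monoI_Suc)
        fix k
        have "r (Suc n + k) < r (Suc n + Suc k)" using r by (rule strict_monoD) simp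
        then show "r' k < r' (Suc k)" using ge[of k] unfolding r'_def by linarith
      qed
      have "asymptotic_radius (X \<circ> diagseq) = asymptotic_radius (X \<circ> (diagseq \<circ> (+) (Suc n)))"
        using asymptotic_radius_shift[of "X \<circ> diagseq" "Suc n"] by (simp add: comp_assoc)
      also have "\<dots> \<le> asymptotic_radius (X \<circ> (diagseq \<circ> (+) (Suc n)) \<circ> r') + ereal (inverse (real (Suc n)))"
        using P_diag[of n] \<open>strict_mono r'\<close> unfolding P_def by blast
      also have "X \<circ> (diagseq \<circ> (+) (Suc n)) \<circ> r' = X \<circ> diagseq \<circ> r \<circ> (+) (Suc n)"
      proof
        fix k
        have "Suc n + r' k = r (Suc n + k)" using ge[of k] unfolding r'_def by linarith
        then show "(X \<circ> (diagseq \<circ> (+) (Suc n)) \<circ> r') k = (X \<circ> diagseq \<circ> r \<circ> (+) (Suc n)) k"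
          by (simp only: o_apply)
      qed
      finally show ?thesis by (simp only: asymptotic_radius_shift)
    qed
    show "asymptotic_radius (X \<circ> diagseq) \<le> asymptotic_radius (X \<circ> diagseq \<circ> r)"
    proof (rule ereal_le_epsilon2)
      fix e :: real assume "e > 0"
      then obtain n where "inverse (real (Suc n)) < e" using reals_Archimedean by blast
      then show "asymptotic_radius (X \<circ> diagseq) \<le> asymptotic_radius (X \<circ> diagseq \<circ> r) + ereal e"
        by (intro order_trans[OF step[of n]] add_left_mono) simp
    qed
  qed
  with subseq_diagseq show thesis by (rule that)
qed

lemma delta_convergent_subsequence:
  fixes X :: "nat \<Rightarrow> 'a::{cat0_space, complete_space}"
  assumes "bounded (range X)"
  obtains r :: "nat \<Rightarrow> nat" and z where "strict_mono r" "delta_lim (X \<circ> r) z"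
proof -
  obtain d :: "nat \<Rightarrow> nat" where d: "strict_mono d"
    "\<And>r::nat \<Rightarrow> nat. strict_mono r \<Longrightarrow> asymptotic_radius (X \<circ> d \<circ> r) = asymptotic_radius (X \<circ> d)"
    using regular_subsequence[OF assms] by blast
  obtain z where z: "asymptotic_radius_at (X \<circ> d) z = asymptotic_radius (X \<circ> d)"
    using asymptotic_center_exists[OF bounded_subseq[OF assms]] by blast
  have "is_asymptotic_center (X \<circ> d \<circ> r) z" if r: "strict_mono r" for r
  proof -
    have "asymptotic_radius_at (X \<circ> d \<circ> r) z \<le> asymptotic_radius (X \<circ> d \<circ> r)"
      using asymptotic_radius_at_subseq[OF r, of "X \<circ> d" z] z d(2)[OF r] by simp
    moreover have "bounded (range (X \<circ> d \<circ> r))"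
      by (intro bounded_subseq assms)
    ultimately show ?thesis
      using asymptotic_radius_le[of "X \<circ> d \<circ> r" z] by (simp only: is_asymptotic_center_iff antisym)
  qed
  then have "delta_lim (X \<circ> d) z"
    using bounded_subseq[OF assms] by (simp add: delta_lim_def)
  with d(1) show thesis by (rule that)
qed

section \<open>Opial's argument\<close>

lemma delta_lim_center:
  fixes X :: "nat \<Rightarrow> 'a::cat0_space"
  assumes "delta_lim X z"
  shows "bounded (range X)" "asymptotic_radius_at X z = asymptotic_radius X"
proof -
  show b: "bounded (range X)" using assms by (simp add: delta_lim_def)
  have "is_asymptotic_center (X \<circ> id) z"
    using assms strict_mono_id unfolding delta_lim_def by blast
  then show "asymptotic_radius_at X z = asymptotic_radius X"
    using is_asymptotic_center_iff[OF b] by simp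
qed

text \<open>Convergence of the distances makes the asymptotic radius at \<open>p\<close> equal to
  \<open>l p\<close> along every time sequence. Two accumulation points minimize \<open>l\<close>
  over \<open>F\<close>, so both are centers of one sequence and coincide; bounded sequences having
  \<Delta>-convergent subsequences, this yields convergence of the whole family.\<close>

lemma Opial_delta_convergence:
  fixes f :: "real \<Rightarrow> 'a::{cat0_space, complete_space}"
  assumes bounded: "bounded (f ` {0..})"
    and conv: "\<And>p. p \<in> F \<Longrightarrow> ((\<lambda>t. dist (f t) p) \<longlongrightarrow> l p) at_top"
    and accum: "\<And>z. delta_accumulation_point f z \<Longrightarrow> z \<in> F"
  shows "\<exists>z\<in>F. delta_lim_at_top f z"
proof -
  have radius: "asymptotic_radius_at (\<lambda>k. f (\<tau> k)) p = ereal (l p)"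
    if "filterlim \<tau> at_top sequentially" "p \<in> F" for \<tau> p
  proof -
    have "(\<lambda>k. dist p (f (\<tau> k))) \<longlonglongrightarrow> l p"
      using filterlim_compose[OF conv[OF that(2)] that(1)] by (simp add: dist_commute)
    then show ?thesis
      unfolding asymptotic_radius_at_def by (intro lim_imp_Limsup) auto
  qed
  have le: "l z \<le> l p"
    if "filterlim \<tau> at_top sequentially" "delta_lim (\<lambda>k. f (\<tau> k)) z" "z \<in> F" "p \<in> F" for \<tau> z p
    using delta_lim_center(2)[OF that(2)] asymptotic_radius_le[of "\<lambda>k. f (\<tau> k)" p] radius[OF that(1)] that(3,4)
    by (simp flip: ereal_less_eq(3))
  have unique: "z' = z" if z: "delta_accumulation_point f z" and z': "delta_accumulation_point f z'" for z z'
  proof -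
    obtain \<tau> where \<tau>: "filterlim \<tau> at_top sequentially" "delta_lim (\<lambda>k. f (\<tau> k)) z"
      using z by (auto simp: delta_accumulation_point_def)
    obtain \<tau>' where \<tau>': "filterlim \<tau>' at_top sequentially" "delta_lim (\<lambda>k. f (\<tau>' k)) z'"
      using z' by (auto simp: delta_accumulation_point_def)
    have "l z = l z'"
      using le[OF \<tau>] le[OF \<tau>'] accum z z' by (intro antisym) auto
    then have "asymptotic_radius_at (\<lambda>k. f (\<tau> k)) z' = asymptotic_radius (\<lambda>k. f (\<tau> k))"
      using delta_lim_center(2)[OF \<tau>(2)] radius[OF \<tau>(1)] accum z z' by simp
    then have "is_asymptotic_center (\<lambda>k. f (\<tau> k)) z'" "is_asymptotic_center (\<lambda>k. f (\<tau> k)) z"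
      using delta_lim_center[OF \<tau>(2)] by (auto simp: is_asymptotic_center_iff)
    then show ?thesis by (auto simp: is_asymptotic_center_def)
  qed
  have sub: "\<exists>r z. strict_mono (r :: nat \<Rightarrow> nat) \<and> delta_lim (\<lambda>k. f (\<tau> (r k))) z \<and> delta_accumulation_point f z"
    if \<tau>: "\<forall>k. \<tau> k \<ge> 0" "filterlim \<tau> at_top sequentially" for \<tau>
  proof -
    have "bounded (range (\<lambda>k. f (\<tau> k)))"
      using \<tau>(1) by (intro bounded_subset[OF bounded]) auto
    then obtain r :: "nat \<Rightarrow> nat" and z where r: "strict_mono r" "delta_lim ((\<lambda>k. f (\<tau> k)) \<circ> r) z"
      using delta_convergent_subsequence by blast
    then have "delta_lim (\<lambda>k. f (\<tau> (r k))) z" by (simp add: comp_def)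
    moreover have "filterlim (\<lambda>k. \<tau> (r k)) at_top sequentially"
      using filterlim_compose[OF \<tau>(2) filterlim_subseq[OF r(1)]] .
    ultimately show ?thesis
      using r(1) \<tau>(1) unfolding delta_accumulation_point_def
      by (intro exI[of _ r] exI[of _ z] conjI exI[of _ "\<lambda>k. \<tau> (r k)"]) auto
  qed
  \<comment> \<open>The times 0, 1, 2, ... already provide an accumulation point.\<close>
  obtain z where z: "delta_accumulation_point f z"
    using sub[of real] filterlim_real_sequentially by auto
  have "delta_lim_at_top f z"
    unfolding delta_lim_at_top_def delta_lim_def
  proof (intro allI impI conjI)
    fix \<tau> :: "nat \<Rightarrow> real" assume \<tau>: "\<forall>k. \<tau> k \<ge> 0" "filterlim \<tau> at_top sequentially"
    show b: "bounded (range (\<lambda>k. f (\<tau> k)))"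
      using \<tau>(1) by (intro bounded_subset[OF bounded]) auto
    fix r :: "nat \<Rightarrow> nat" assume r: "strict_mono r"
    have \<tau>r: "filterlim (\<lambda>k. \<tau> (r k)) at_top sequentially"
      using filterlim_compose[OF \<tau>(2) filterlim_subseq[OF r]] .
    obtain r' :: "nat \<Rightarrow> nat" and z' where r': "strict_mono r'" "delta_lim (\<lambda>k. f (\<tau> (r (r' k)))) z'"
      "delta_accumulation_point f z'"
      using sub[of "\<lambda>k. \<tau> (r k)"] \<tau>(1) \<tau>r by blast
    have "z' = z" using unique[OF z r'(3)] .
    let ?Y = "\<lambda>k. f (\<tau> (r k))"
    \<comment> \<open>At \<open>z\<close> the radius is \<open>l z\<close> along both sequences,
      whereas the infimum can only shrink along the subsequence; hence \<open>z\<close> is optimal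
      for \<open>?Y\<close> too.\<close>
    have "asymptotic_radius_at ?Y z = asymptotic_radius_at (\<lambda>k. f (\<tau> (r (r' k)))) z"
      using radius[OF \<tau>r] radius[OF filterlim_compose[OF \<tau>r filterlim_subseq[OF r'(1)]]] accum[OF z] by simp
    also have "\<dots> = asymptotic_radius (?Y \<circ> r')"
      using delta_lim_center(2)[OF r'(2)] \<open>z' = z\<close> by (simp add: comp_def)
    also have "\<dots> \<le> asymptotic_radius ?Y"
      by (rule asymptotic_radius_subseq[OF r'(1)])
    finally have "asymptotic_radius_at ?Y z = asymptotic_radius ?Y"
      using asymptotic_radius_le[of ?Y z] by (rule antisym)
    moreover have "bounded (range ?Y)"
      using bounded_subseq[OF b, of r] by (simp add: comp_def)
    ultimately show "is_asymptotic_center ((\<lambda>k. f (\<tau> k)) \<circ> r) z"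
      by (simp add: is_asymptotic_center_iff comp_def)
  qed
  with accum[OF z] show ?thesis by blast
qed

section \<open>Convergence of the semigroup\<close>

theorem theorem5p4:
  fixes A :: "'a::{cat0_space, complete_space} \<Rightarrow> 'a tangent set" and x :: 'a
  assumes "geodesic_extension_property TYPE('a)"
    and "vector_field A"
    and "monotone_vf A"
    and "surjectivity_condition A"
    and "stationary_points A \<noteq> {}"
    and "x \<in> closure (vf_dom A)"
  shows "(\<forall>t\<ge>0. convergent (semigroup_approx A t x)) \<and>
    bounded ((\<lambda>t. generated_semigroup A t x) ` {0..}) \<and>
    ((\<forall>z. delta_accumulation_point (\<lambda>t. generated_semigroup A t x) z \<longrightarrow> z \<in> stationary_points A) \<longrightarrow>
     (\<exists>z\<in>stationary_points A. delta_lim_at_top (\<lambda>t. generated_semigroup A t x) z))"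
proof -
  interpret monotone_surjective_field A
    using assms by unfold_locales
  let ?S = "\<lambda>t. generated_semigroup A t x"
  note Fejer = generated_semigroup_Fejer[OF assms(6)]
  obtain p where p: "p \<in> stationary_points A" using assms(5) by blast
  \<comment> \<open>The orbit never leaves the ball around \<open>p\<close> whose radius is the
    distance at time 0.\<close>
  have bounded: "bounded (?S ` {0..})"
    unfolding bounded_any_center[of _ p] using Fejer[OF p order_refl]
    by (auto simp: dist_commute[of p])
  have "\<exists>z\<in>stationary_points A. delta_lim_at_top ?S z"
    if "\<forall>z. delta_accumulation_point ?S z \<longrightarrow> z \<in> stationary_points A"
  proof (rule Opial_delta_convergence[OF bounded])
    \<comment> \<open>By Fejer monotonicity the distance to \<open>q\<close> decreases on
      nonnegative times, hence tends to its infimum there.\<close>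
    show "((\<lambda>t. dist (?S t) q) \<longlongrightarrow> (INF t\<in>{0..}. dist (?S t) q)) at_top"
      if q: "q \<in> stationary_points A" for q
    proof (rule order_tendstoI)
      have bdd: "bdd_below ((\<lambda>t. dist (?S t) q) ` {0..})"
        by (intro bdd_belowI[of _ 0]) auto
      show "eventually (\<lambda>t. a < dist (?S t) q) at_top" if "a < (INF t\<in>{0..}. dist (?S t) q)" for a
        using eventually_ge_at_top[of 0]
      proof eventually_elim
        case (elim t)
        have "(INF t\<in>{0..}. dist (?S t) q) \<le> dist (?S t) q"
          using elim by (intro cINF_lower[OF bdd]) simp
        with that show ?case by linarith
      qed
      show "eventually (\<lambda>t. dist (?S t) q < a) at_top" if less: "(INF t\<in>{0..}. dist (?S t) q) < a" for a
      proof -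
        obtain s where s: "s \<ge> 0" "dist (?S s) q < a"
          using less cINF_less_iff[OF _ bdd] by auto
        show ?thesis
          using eventually_ge_at_top[of s]
          by eventually_elim (use Fejer[OF q s(1)] s(2) in \<open>meson le_less_trans\<close>)
      qed
    qed
  qed (use that in blast)
  with bounded semigroup_approx_convergent[OF assms(6)] show ?thesis by blast
qed

end
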